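(* Let $G$ be a finitely generated hyperbolic group and let $\phi\in\mathrm{Aut}(G)$ have finite order. Then the $\phi$-twisted conjugacy problem in $G$ is solvable: there is an algorithm which, given $u,v\in G$ (as words in a finite generating set), decides whether there exists $g\in G$ with $g^{-1}u\phi(g)=v$.
   Context: Given a group $G$ and $\phi\in\mathrm{Aut}(G)$, $u\in G$ is $\phi$-twisted conjugate to $v\in G$ if there exists $g\in G$ with $g^{-1}u\phi(g)=v$; the $\phi$-twisted conjugacy problem is solvable if this relation is algorithmically decidable. *)

theory Defs
  imports Complex_Main "HOL-Algebra.Group" "HOL-Library.Nat_Bijection"
begin

fun PR :: "(nat list \<Rightarrow> nat) \<Rightarrow> (nat list \<Rightarrow> nat) \<Rightarrow> nat \<Rightarrow> nat list \<Rightarrow> nat" where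
  "PR g h 0 ys = g ys"
| "PR g h (Suc k) ys = h (k # PR g h k ys # ys)"

inductive recfn :: "nat \<Rightarrow> (nat list \<Rightarrow> nat) \<Rightarrow> bool" where
  rf_zero: "recfn n (\<lambda>_. 0)"
| rf_succ: "recfn 1 (\<lambda>xs. Suc (hd xs))"
| rf_proj: "i < n \<Longrightarrow> recfn n (\<lambda>xs. xs ! i)"
| rf_comp: "recfn m f \<Longrightarrow> length gs = m \<Longrightarrow> (\<forall>g\<in>set gs. recfn n g)
            \<Longrightarrow> recfn n (\<lambda>xs. f (map (\<lambda>g. g xs) gs))"
| rf_prim: "recfn n g \<Longrightarrow> recfn (Suc (Suc n)) h
            \<Longrightarrow> recfn (Suc n) (\<lambda>xs. PR g h (hd xs) (tl xs))"
| rf_mu: "recfn (Suc n) g \<Longrightarrow> (\<forall>xs. length xs = n \<longrightarrow> (\<exists>y. g (y # xs) = 0))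
            \<Longrightarrow> recfn n (\<lambda>xs. LEAST y. g (y # xs) = 0)"

definition decidable_set :: "nat set \<Rightarrow> bool" where
  "decidable_set A \<longleftrightarrow> (\<exists>f. recfn 1 f \<and> (\<forall>x. f [x] = (if x \<in> A then 1 else 0)))"

text \<open>A letter k stands for generator gens!(k div 2), inverted when k is odd.\<close>

definition valid_word :: "'g list \<Rightarrow> nat list \<Rightarrow> bool" where
  "valid_word gens w \<longleftrightarrow> (\<forall>k\<in>set w. k < 2 * length gens)"

definition letter_val :: "('g, 'm) monoid_scheme \<Rightarrow> 'g list \<Rightarrow> nat \<Rightarrow> 'g" where
  "letter_val G gens k = (if odd k then inv\<^bsub>G\<^esub> (gens ! (k div 2)) else gens ! (k div 2))"

definition word_eval :: "('g, 'm) monoid_scheme \<Rightarrow> 'g list \<Rightarrow> nat list \<Rightarrow> 'g" where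
  "word_eval G gens w = foldr (\<lambda>k acc. letter_val G gens k \<otimes>\<^bsub>G\<^esub> acc) w \<one>\<^bsub>G\<^esub>"

definition generates :: "('g, 'm) monoid_scheme \<Rightarrow> 'g list \<Rightarrow> bool" where
  "generates G gens \<longleftrightarrow> set gens \<subseteq> carrier G \<and>
     (\<forall>g\<in>carrier G. \<exists>w. valid_word gens w \<and> word_eval G gens w = g)"

definition word_length :: "('g, 'm) monoid_scheme \<Rightarrow> 'g list \<Rightarrow> 'g \<Rightarrow> nat" where
  "word_length G gens g = (LEAST n. \<exists>w. valid_word gens w \<and> length w = n \<and> word_eval G gens w = g)"

definition word_dist :: "('g, 'm) monoid_scheme \<Rightarrow> 'g list \<Rightarrow> 'g \<Rightarrow> 'g \<Rightarrow> real" where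
  "word_dist G gens x y = real (word_length G gens (inv\<^bsub>G\<^esub> x \<otimes>\<^bsub>G\<^esub> y))"

definition gromov_product :: "('g, 'm) monoid_scheme \<Rightarrow> 'g list \<Rightarrow> 'g \<Rightarrow> 'g \<Rightarrow> 'g \<Rightarrow> real" where
  "gromov_product G gens w x y =
     (word_dist G gens x w + word_dist G gens y w - word_dist G gens x y) / 2"

definition hyperbolic_group :: "('g, 'm) monoid_scheme \<Rightarrow> 'g list \<Rightarrow> bool" where
  "hyperbolic_group G gens \<longleftrightarrow> (\<exists>\<delta>::real. \<delta> \<ge> 0 \<and>
     (\<forall>w\<in>carrier G. \<forall>x\<in>carrier G. \<forall>y\<in>carrier G. \<forall>z\<in>carrier G.
        gromov_product G gens w x z \<ge>
          min (gromov_product G gens w x y) (gromov_product G gens w y z) - \<delta>))"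

definition twisted_conj :: "('g, 'm) monoid_scheme \<Rightarrow> ('g \<Rightarrow> 'g) \<Rightarrow> 'g \<Rightarrow> 'g \<Rightarrow> bool" where
  "twisted_conj G \<phi> u v \<longleftrightarrow> (\<exists>g\<in>carrier G. inv\<^bsub>G\<^esub> g \<otimes>\<^bsub>G\<^esub> u \<otimes>\<^bsub>G\<^esub> \<phi> g = v)"

definition twisted_conj_problem ::
  "('g, 'm) monoid_scheme \<Rightarrow> 'g list \<Rightarrow> ('g \<Rightarrow> 'g) \<Rightarrow> nat set" where
  "twisted_conj_problem G gens \<phi> =
     {prod_encode (list_encode u, list_encode v) | u v.
        valid_word gens u \<and> valid_word gens v \<and>
        twisted_conj G \<phi> (word_eval G gens u) (word_eval G gens v)}"

end

theory Submission
  imports Defs "HOL-Real_Asymp.Real_Asymp"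
begin

text \<open>
  Enlarge the generating set to a finite \<open>\<phi>\<close>-invariant one. For its word metric
  \<open>x \<mapsto> u \<phi>(x)\<close> is an isometry, and stability of quasigeodesics in the hyperbolic metric of the
  given generators shows that it displaces the points of a geodesic from \<open>1\<close> to \<open>g\<close> by an amount
  linear in \<open>|u| + |g\<inverse> u \<phi>(g)|\<close>. Hence twisted conjugate elements are joined by a chain
  \<open>u\<^sub>i\<^sub>+\<^sub>1 = s\<^sub>i\<inverse> u\<^sub>i \<phi>(s\<^sub>i)\<close> of elements of linearly bounded length, \<open>s\<^sub>i\<close> being letters. Geodesics with
  neighbouring ends fellow travel, so a word is made geodesic by relations from
  a fixed finite set without growing much. So twisted conjugacy is reachability in a finite rewriting system
  restricted to words of linearly bounded length.
\<close>

section \<open>Recursive functions\<close>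

text \<open>The obstacle is that \<phi> need not preserve the metric of the given generators, the
  one in which hyperbolicity is assumed, while hyperbolicity of the invariant metric is not at hand.
  So both are kept. The hyperbolic metric compares paths; in the invariant one the parameters along
  a geodesic and along its image can be matched without multiplicative error. Finite order makes the
  union of the iterated images of the generators a finite set. The displacement of \<open>x\<close>
  is the length of \<open>inv x \<otimes> (u \<otimes> \<phi> x)\<close>, the twisted conjugate of
  \<open>u\<close> by \<open>x\<close>. Bounding it along a geodesic to \<open>g\<close> bounds
  every intermediate element, and this turns a mere enumeration of positive instances into a finite
  search. A found chain proves twisted conjugacy whatever the bound; geometry is needed only to see
  that the search misses nothing. No normal forms are computed. The relations and the words for the
  images of the letters are finitely many constants of the program, and their existence
  suffices.\<close>

definition computable :: "nat \<Rightarrow> (nat list \<Rightarrow> nat) \<Rightarrow> bool" where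
  "computable n F \<longleftrightarrow> (\<exists>f. recfn n f \<and> (\<forall>xs. length xs = n \<longrightarrow> f xs = F xs))"

definition decidable :: "nat \<Rightarrow> (nat list \<Rightarrow> bool) \<Rightarrow> bool" where
  "decidable n P \<longleftrightarrow> computable n (\<lambda>xs. if P xs then 1 else 0)"

text \<open>Only lists of length \<open>n\<close> matter, so a function built by the rules of
  \<open>recfn\<close> may be replaced by a readable term that agrees with it there.\<close>

lemma computable_cong:
  assumes "computable n F" "\<And>xs. length xs = n \<Longrightarrow> F xs = G xs"
  shows "computable n G"
  using assms unfolding computable_def by metis

lemma decidable_cong:
  assumes "decidable n P" "\<And>xs. length xs = n \<Longrightarrow> P xs = Q xs"
  shows "decidable n Q"
  using assms unfolding decidable_def by (auto elim!: computable_cong)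

section \<open>Composition, variables, primitive recursion and minimisation\<close>

lemma computable_comp:
  assumes F: "computable (length Gs) F" and Gs: "\<And>g. g \<in> set Gs \<Longrightarrow> computable n g"
  shows "computable n (\<lambda>xs. F (map (\<lambda>g. g xs) Gs))"
proof -
  obtain f where f: "recfn (length Gs) f" "\<And>xs. length xs = length Gs \<Longrightarrow> f xs = F xs"
    using F unfolding computable_def by blast
  obtain r where r: "\<And>g. g \<in> set Gs \<Longrightarrow> recfn n (r g)"
    "\<And>g xs. g \<in> set Gs \<Longrightarrow> length xs = n \<Longrightarrow> r g xs = g xs"
    using Gs unfolding computable_def by metis
  have "recfn n (\<lambda>xs. f (map (\<lambda>g. g xs) (map r Gs)))"
    using f(1) r(1) by (intro rf_comp) auto
  moreover have "f (map (\<lambda>g. g xs) (map r Gs)) = F (map (\<lambda>g. g xs) Gs)" if "length xs = n" for xs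
  proof -
    have "map (\<lambda>g. g xs) (map r Gs) = map (\<lambda>g. g xs) Gs"
      using r(2) that by auto
    then show ?thesis using f(2)[of "map (\<lambda>g. g xs) Gs"] by (simp del: map_map)
  qed
  ultimately show ?thesis unfolding computable_def by blast
qed

text \<open>Operations are proved computable once, in the variables \<open>hd xs\<close> and
  \<open>hd (tl xs)\<close>. This rule and its analogues then substitute arbitrary computable terms,
  so that computability proofs follow the syntax of the term.\<close>

lemma computable_comp1:
  assumes "computable (Suc 0) (\<lambda>xs. f (hd xs))" "computable n F"
  shows "computable n (\<lambda>xs. f (F xs))"
  using computable_comp[of "[F]" "\<lambda>xs. f (hd xs)" n] assms by simp

lemma computable_comp2:
  assumes "computable (Suc (Suc 0)) (\<lambda>xs. f (hd xs) (hd (tl xs)))" "computable n F" "computable n G"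
  shows "computable n (\<lambda>xs. f (F xs) (G xs))"
  using computable_comp[of "[F, G]" "\<lambda>xs. f (hd xs) (hd (tl xs))" n] assms by auto

lemma decidable_comp1:
  assumes "decidable (Suc 0) (\<lambda>xs. P (hd xs))" "computable n F"
  shows "decidable n (\<lambda>xs. P (F xs))"
  using assms unfolding decidable_def by (rule computable_comp1)

lemma decidable_comp2:
  assumes "decidable (Suc (Suc 0)) (\<lambda>xs. P (hd xs) (hd (tl xs)))" "computable n F" "computable n G"
  shows "decidable n (\<lambda>xs. P (F xs) (G xs))"
  using assms unfolding decidable_def by (rule computable_comp2)

lemma computable_nth: "i < n \<Longrightarrow> computable n (\<lambda>xs. xs ! i)"
  unfolding computable_def using rf_proj by blast

text \<open>Variables are written with \<open>hd\<close> and \<open>tl\<close> because recursion,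
  minimisation and bounded quantifiers put their new variable at the head of the list and leave just
  such terms behind.\<close>

lemma computable_var:
  "0 < n \<Longrightarrow> computable n (\<lambda>xs. hd xs)"
  "1 < n \<Longrightarrow> computable n (\<lambda>xs. hd (tl xs))"
  "2 < n \<Longrightarrow> computable n (\<lambda>xs. hd (tl (tl xs)))"
  "3 < n \<Longrightarrow> computable n (\<lambda>xs. hd (tl (tl (tl xs))))"
  "4 < n \<Longrightarrow> computable n (\<lambda>xs. hd (tl (tl (tl (tl xs)))))"
  "5 < n \<Longrightarrow> computable n (\<lambda>xs. hd (tl (tl (tl (tl (tl xs))))))"
proof -
  have *: "hd (drop i xs) = xs ! i" if "i < length xs" for i and xs :: "nat list"
    using that by (simp add: hd_drop_conv_nth)
  have **: "computable n (\<lambda>xs. hd (drop i xs))" if "i < n" for i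
    by (rule computable_cong[OF computable_nth[OF that]]) (simp add: * that)
  show "0 < n \<Longrightarrow> computable n (\<lambda>xs. hd xs)" using **[of 0] by simp
  show "1 < n \<Longrightarrow> computable n (\<lambda>xs. hd (tl xs))" using **[of 1] by (simp add: drop_Suc)
  show "2 < n \<Longrightarrow> computable n (\<lambda>xs. hd (tl (tl xs)))"
    using **[of 2] by (simp add: drop_Suc eval_nat_numeral)
  show "3 < n \<Longrightarrow> computable n (\<lambda>xs. hd (tl (tl (tl xs))))"
    using **[of 3] by (simp add: drop_Suc eval_nat_numeral)
  show "4 < n \<Longrightarrow> computable n (\<lambda>xs. hd (tl (tl (tl (tl xs)))))"
    using **[of 4] by (simp add: drop_Suc eval_nat_numeral)
  show "5 < n \<Longrightarrow> computable n (\<lambda>xs. hd (tl (tl (tl (tl (tl xs))))))"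
    using **[of 5] by (simp add: drop_Suc eval_nat_numeral)
qed

lemma computable_Suc: "computable n F \<Longrightarrow> computable n (\<lambda>xs. Suc (F xs))"
  by (rule computable_comp1) (use rf_succ in \<open>auto simp: computable_def\<close>)

lemma computable_const: "computable n (\<lambda>_. c)"
proof (induction c)
  case 0
  then show ?case using rf_zero unfolding computable_def by blast
qed (rule computable_Suc)

lemma map_nth_upt: "length xs = n \<Longrightarrow> map (\<lambda>g. g xs) (map (\<lambda>i xs. xs ! i) [0..<n]) = xs"
  by (auto simp: list_eq_iff_nth_eq)

lemma computable_subst:
  assumes F: "computable (Suc n) F" and t: "computable n t"
  shows "computable n (\<lambda>xs. F (t xs # xs))"
proof -
  let ?Gs = "t # map (\<lambda>i xs. xs ! i) [0..<n]"
  have "computable n (\<lambda>xs. F (map (\<lambda>g. g xs) ?Gs))"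
    using F t by (intro computable_comp) (auto intro: computable_nth)
  then show ?thesis
    by (rule computable_cong) (simp only: list.map map_nth_upt)
qed

lemma computable_select:
  assumes "computable m F" "length is = m" "\<And>i. i \<in> set is \<Longrightarrow> i < n"
  shows "computable n (\<lambda>xs. F (map ((!) xs) is))"
  using computable_comp[of "map (\<lambda>i xs. xs ! i) is" F n] assms
  by (auto intro: computable_nth simp: comp_def)

lemma map_nth_tl_tl:
  "length ys = Suc (Suc n) \<Longrightarrow> map ((!) ys) [2..<Suc (Suc n)] = tl (tl ys)"
  by (auto simp: list_eq_iff_nth_eq nth_tl simp del: upt_Suc)

lemma nth_0_eq_hd: "length xs = Suc n \<Longrightarrow> xs ! 0 = hd xs"
  by (cases xs) auto

lemma PR_rec_nat: "PR g h k ys = rec_nat (g ys) (\<lambda>k r. h (k # r # ys)) k"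
  by (induction k) auto

lemma computable_rec:
  assumes g: "computable n g" and h: "computable (Suc (Suc n)) (\<lambda>ys. h (hd ys) (hd (tl ys)) (tl (tl ys)))"
    and t: "computable n t"
  shows "computable n (\<lambda>xs. rec_nat (g xs) (\<lambda>k r. h k r xs) (t xs))"
proof -
  obtain g' where g': "recfn n g'" "\<And>xs. length xs = n \<Longrightarrow> g' xs = g xs"
    using g unfolding computable_def by blast
  obtain h' where h': "recfn (Suc (Suc n)) h'"
    "\<And>ys. length ys = Suc (Suc n) \<Longrightarrow> h' ys = h (hd ys) (hd (tl ys)) (tl (tl ys))"
    using h unfolding computable_def by metis
  have "recfn (Suc n) (\<lambda>xs. PR g' h' (hd xs) (tl xs))"
    using g'(1) h'(1) by (rule rf_prim)
  then have "computable (Suc n) (\<lambda>xs. PR g' h' (hd xs) (tl xs))"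
    unfolding computable_def by blast
  from computable_subst[OF this t]
  show ?thesis
    by (rule computable_cong) (simp add: PR_rec_nat g'(2) h'(2))
qed

text \<open>A witness is required for every parameter list because \<open>rf_mu\<close> admits only
  total minimisation.\<close>

lemma computable_Least:
  assumes P: "decidable (Suc n) (\<lambda>ys. P (hd ys) (tl ys))"
    and ex: "\<And>xs. length xs = n \<Longrightarrow> \<exists>y. P y xs"
  shows "computable n (\<lambda>xs. LEAST y. P y xs)"
proof -
  \<comment> \<open>Truth is coded by 1, but \<open>rf_mu\<close> searches for a zero: this
    recursion exchanges 0 and 1.\<close>
  have "computable (Suc n) (\<lambda>ys. rec_nat 1 (\<lambda>_ _. 0) (if P (hd ys) (tl ys) then 1 else 0))"
    using P unfolding decidable_def by (intro computable_rec computable_const)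
  then obtain f where f: "recfn (Suc n) f"
    "\<And>ys. length ys = Suc n \<Longrightarrow> f ys = rec_nat 1 (\<lambda>_ _. 0) (if P (hd ys) (tl ys) then 1 else 0::nat)"
    unfolding computable_def by blast
  have f0: "f (y # xs) = 0 \<longleftrightarrow> P y xs" if "length xs = n" for y xs
    using f(2)[of "y # xs"] that by simp
  have "recfn n (\<lambda>xs. LEAST y. f (y # xs) = 0)"
    using f(1) ex f0 by (intro rf_mu) auto
  then show ?thesis
    unfolding computable_def using f0 by auto
qed

subsection \<open>Arithmetic and logic\<close>

text \<open>A case distinction is a recursion on the truth value: the base is the second branch, the
  only possible step gives the first.\<close>

lemma computable_if:
  assumes "decidable n P" "computable n F" "computable n G"
  shows "computable n (\<lambda>xs. if P xs then F xs else G xs)"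
proof -
  have "computable n (\<lambda>xs. rec_nat (G xs) (\<lambda>_ _. F xs) (if P xs then 1 else 0))"
  proof (rule computable_rec)
    show "computable (Suc (Suc n)) (\<lambda>ys. F (tl (tl ys)))"
      using computable_select[OF assms(2), of "[2..<Suc (Suc n)]" "Suc (Suc n)"]
      by (auto elim!: computable_cong simp del: upt_Suc simp: map_nth_tl_tl)
  qed (use assms in \<open>auto simp: decidable_def\<close>)
  then show ?thesis by (rule computable_cong) simp
qed

lemma computable_add:
  assumes "computable n F" "computable n G"
  shows "computable n (\<lambda>xs. F xs + G xs)"
proof -
  have "rec_nat a (\<lambda>_ r. Suc r) b = a + b" for a b :: nat by (induction b) auto
  moreover have "computable n (\<lambda>xs. rec_nat (F xs) (\<lambda>_ r. Suc r) (G xs))"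
    using assms by (intro computable_rec computable_Suc computable_var) auto
  ultimately show ?thesis by simp
qed

lemma computable_funpow:
  assumes "computable n F" "computable n N" "computable (Suc (Suc n)) (\<lambda>ys. h (hd (tl ys)) (tl (tl ys)))"
  shows "computable n (\<lambda>xs. ((\<lambda>r. h r xs) ^^ N xs) (F xs))"
proof -
  have "((\<lambda>r. h r xs) ^^ k) a = rec_nat a (\<lambda>_ r. h r xs) k" for a k xs by (induction k) auto
  then show ?thesis using assms by (simp add: computable_rec)
qed

lemma computable_minus:
  assumes "computable n F" "computable n G"
  shows "computable n (\<lambda>xs. F xs - G xs)"
proof -
  \<comment> \<open>The predecessor is the recursion that returns its own counter.\<close>
  have pred: "rec_nat 0 (\<lambda>k _. k) b = b - 1" for b :: nat by (cases b) auto
  have "computable m (\<lambda>xs. rec_nat 0 (\<lambda>k _. k) (F xs))" if "computable m F" for m F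
    using that by (intro computable_rec computable_const computable_var) auto
  then have 1: "computable m F \<Longrightarrow> computable m (\<lambda>xs. F xs - 1)" for m F by (simp only: pred)
  have "((\<lambda>r. r - 1) ^^ b) a = a - b" for a b :: nat by (induction b) auto
  moreover have "computable n (\<lambda>xs. ((\<lambda>r. r - 1) ^^ G xs) (F xs))"
    by (intro computable_funpow assms 1 computable_var) auto
  ultimately show ?thesis by simp
qed

lemma computable_mult:
  assumes "computable n F"
  shows "computable n (\<lambda>xs. c * F xs)"
proof (induction c)
  case (Suc c)
  then show ?case using computable_add[OF assms] by simp
qed (simp add: computable_const)

lemma decidable_less:
  assumes "computable n F" "computable n G"
  shows "decidable n (\<lambda>xs. F xs < G xs)"
proof -
  have "computable n (\<lambda>xs. 1 - (1 - (G xs - F xs)))"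
    by (intro computable_minus assms computable_const)
  then show ?thesis unfolding decidable_def by (rule computable_cong) auto
qed

lemma decidable_not: "decidable n P \<Longrightarrow> decidable n (\<lambda>xs. \<not> P xs)"
  unfolding decidable_def by (drule computable_minus[OF computable_const[of n 1]])
    (auto elim: computable_cong)

lemma decidable_const: "decidable n (\<lambda>_. b)"
  unfolding decidable_def by (rule computable_const)

lemma decidable_conj:
  assumes "decidable n P" "decidable n Q"
  shows "decidable n (\<lambda>xs. P xs \<and> Q xs)"
proof -
  have "computable n (\<lambda>xs. if P xs then if Q xs then 1 else 0 else 0)"
    using assms by (intro computable_if computable_const)
  then show ?thesis unfolding decidable_def by (rule computable_cong) auto
qed

lemma decidable_disj:
  "decidable n P \<Longrightarrow> decidable n Q \<Longrightarrow> decidable n (\<lambda>xs. P xs \<or> Q xs)"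
  using decidable_not[OF decidable_conj[OF decidable_not decidable_not], of n P Q] by simp

lemma decidable_imp:
  "decidable n P \<Longrightarrow> decidable n Q \<Longrightarrow> decidable n (\<lambda>xs. P xs \<longrightarrow> Q xs)"
  by (drule decidable_not, drule decidable_disj, assumption) (auto elim: decidable_cong)

lemma decidable_eq:
  assumes "computable n F" "computable n G"
  shows "decidable n (\<lambda>xs. F xs = G xs)"
proof -
  have "decidable n (\<lambda>xs. \<not> F xs < G xs \<and> \<not> G xs < F xs)"
    by (intro decidable_conj decidable_not decidable_less assms)
  then show ?thesis by (rule decidable_cong) auto
qed

text \<open>A finite disjunction is written into the program, whatever the origin of
  \<open>A\<close>. The short relations of the group enter the algorithm in this way.\<close>

lemma decidable_bex_finite:
  assumes "finite A" "\<And>a. a \<in> A \<Longrightarrow> decidable n (P a)"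
  shows "decidable n (\<lambda>xs. \<exists>a\<in>A. P a xs)"
  using assms by (induction A) (auto intro: decidable_const decidable_disj)

lemma decidable_all_le:
  assumes P: "decidable (Suc n) (\<lambda>ys. P (hd ys) (tl ys))" and t: "computable n t"
  shows "decidable n (\<lambda>xs. \<forall>y\<le>t xs. P y xs)"
proof -
  \<comment> \<open>The search ends at the first counterexample or, by the second disjunct, at the
    bound \<open>hd xs\<close>. So the quantified statement holds iff the result is not below the
    bound, which is later set to \<open>Suc (t xs)\<close>.\<close>
  have "computable (Suc n) (\<lambda>xs. LEAST y. \<not> P y (tl xs) \<or> \<not> y < hd xs)"
  proof (rule computable_Least)
    have *: "decidable (Suc (Suc n)) (\<lambda>xs. P (hd xs) (tl (tl xs)))"
    proof -
      have "computable (Suc (Suc n))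
        (\<lambda>xs. (\<lambda>ys. if P (hd ys) (tl ys) then 1 else 0) (map ((!) xs) (0 # [2..<Suc (Suc n)])))"
        using P unfolding decidable_def by (rule computable_select) auto
      then show ?thesis unfolding decidable_def
        by (rule computable_cong) (simp add: map_nth_tl_tl nth_0_eq_hd del: upt_Suc)
    qed
    show "decidable (Suc (Suc n)) (\<lambda>ys. \<not> P (hd ys) (tl (tl ys)) \<or> \<not> hd ys < hd (tl ys))"
      by (intro decidable_disj decidable_not decidable_less computable_var *) auto
    fix xs :: "nat list"
    show "\<exists>y. \<not> P y (tl xs) \<or> \<not> y < hd xs" by (rule exI[of _ "hd xs"]) simp
  qed
  from computable_subst[OF this computable_Suc[OF t]]
  have "decidable n (\<lambda>xs. \<not> (LEAST y. \<not> P y xs \<or> \<not> y < Suc (t xs)) < Suc (t xs))"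
    using t by (intro decidable_not decidable_less) (auto intro: computable_Suc)
  then show ?thesis
  proof (rule decidable_cong)
    fix xs
    let ?Q = "\<lambda>y. \<not> P y xs \<or> \<not> y < Suc (t xs)"
    have "?Q (Suc (t xs))" by simp
    then have L: "?Q (LEAST y. ?Q y)" by (rule LeastI)
    have "(LEAST y. ?Q y) \<le> y" if "\<not> P y xs" for y using that by (intro Least_le) simp
    with L show "(\<not> (LEAST y. ?Q y) < Suc (t xs)) = (\<forall>y\<le>t xs. P y xs)"
      by (force simp: less_Suc_eq_le not_le intro: le_trans)
  qed
qed

lemma decidable_ex_le:
  assumes P: "decidable (Suc n) (\<lambda>ys. P (hd ys) (tl ys))" and t: "computable n t"
  shows "decidable n (\<lambda>xs. \<exists>y\<le>t xs. P y xs)"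
  using decidable_not[OF decidable_all_le[OF decidable_not[OF P] t]] by simp

subsection \<open>Codes of pairs and lists\<close>

lemma prod_encode_mono:
  assumes "a \<le> a'" "b \<le> b'"
  shows "prod_encode (a, b) \<le> prod_encode (a', b')"
proof -
  have "triangle m \<le> triangle m'" if "m \<le> m'" for m m' :: nat
    using that unfolding triangle_def by (intro div_le_mono mult_le_mono) auto
  then show ?thesis using assms by (simp add: prod_encode_def add_mono)
qed

lemma computable_prod_encode:
  assumes "computable n F" "computable n G"
  shows "computable n (\<lambda>xs. prod_encode (F xs, G xs))"
proof -
  have tri: "rec_nat 0 (\<lambda>k r. r + Suc k) m = triangle m" for m by (induction m) auto
  have "computable n (\<lambda>xs. rec_nat 0 (\<lambda>k r. r + Suc k) (F xs + G xs) + F xs)"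
    using assms by (intro computable_add computable_rec computable_Suc computable_const computable_var) auto
  then show ?thesis unfolding tri by (simp add: prod_encode_def)
qed

text \<open>Both components of a pair are at most its code, so each is found by minimisation over a
  bounded search for the other.\<close>

lemma computable_prod_decode:
  assumes F: "computable n F"
  shows "computable n (\<lambda>xs. fst (prod_decode (F xs)))" "computable n (\<lambda>xs. snd (prod_decode (F xs)))"
proof -
  have le: "a \<le> z" "b \<le> z" if "prod_encode (a, b) = z" for a b z
    using that le_prod_encode_1 le_prod_encode_2 by blast+
  have 1: "(\<exists>b\<le>z. prod_encode (a, b) = z) \<longleftrightarrow> a = fst (prod_decode z)" for a z
    by (metis le(2) prod.collapse prod.sel(1) prod_decode_inverse prod_encode_inverse)
  have 2: "(\<exists>a\<le>z. prod_encode (a, b) = z) \<longleftrightarrow> b = snd (prod_decode z)" for b z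
    by (metis le(1) prod.collapse prod.sel(2) prod_decode_inverse prod_encode_inverse)
  have "computable (Suc 0) (\<lambda>xs. LEAST a. \<exists>b\<le>hd xs. prod_encode (a, b) = hd xs)"
    by (intro computable_Least decidable_ex_le decidable_eq computable_prod_encode computable_var)
      (auto simp: 1)
  then have "computable (Suc 0) (\<lambda>xs. fst (prod_decode (hd xs)))"
    by (simp add: 1 Least_equality)
  then show "computable n (\<lambda>xs. fst (prod_decode (F xs)))" using F by (rule computable_comp1)
  have "computable (Suc 0) (\<lambda>xs. LEAST b. \<exists>a\<le>hd xs. prod_encode (a, b) = hd xs)"
    by (intro computable_Least decidable_ex_le decidable_eq computable_prod_encode computable_var)
      (auto simp: 2)
  then have "computable (Suc 0) (\<lambda>xs. snd (prod_decode (hd xs)))"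
    by (simp add: 2 Least_equality)
  then show "computable n (\<lambda>xs. snd (prod_decode (F xs)))" using F by (rule computable_comp1)
qed

section \<open>List operations on codes\<close>

definition code_cons :: "nat \<Rightarrow> nat \<Rightarrow> nat" where
  "code_cons x c = Suc (prod_encode (x, c))"

definition code_hd :: "nat \<Rightarrow> nat" where
  "code_hd c = fst (prod_decode (c - 1))"

definition code_tl :: "nat \<Rightarrow> nat" where
  "code_tl c = (if c = 0 then 0 else snd (prod_decode (c - 1)))"

lemma code_cons_encode [simp]: "code_cons x (list_encode xs) = list_encode (x # xs)"
  by (simp add: code_cons_def)

lemma code_hd_encode [simp]: "code_hd (list_encode (x # xs)) = x"
  by (simp add: code_hd_def)

lemma code_tl_encode [simp]: "code_tl (list_encode xs) = list_encode (tl xs)"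
  by (cases xs) (auto simp: code_tl_def)

lemma list_encode_eq_0 [simp]: "list_encode xs = 0 \<longleftrightarrow> xs = []"
  by (cases xs) auto

declare list_encode.simps(2) [simp del]

lemma computable_code_cons:
  "computable n F \<Longrightarrow> computable n G \<Longrightarrow> computable n (\<lambda>xs. code_cons (F xs) (G xs))"
  unfolding code_cons_def by (intro computable_Suc computable_prod_encode)

lemma computable_code_hd: "computable n F \<Longrightarrow> computable n (\<lambda>xs. code_hd (F xs))"
  unfolding code_hd_def by (intro computable_prod_decode computable_minus computable_const)

lemma computable_code_tl: "computable n F \<Longrightarrow> computable n (\<lambda>xs. code_tl (F xs))"
  unfolding code_tl_def
  by (intro computable_if decidable_eq computable_prod_decode computable_minus computable_const)

definition code_drop :: "nat \<Rightarrow> nat \<Rightarrow> nat" where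
  "code_drop k c = (code_tl ^^ k) c"

lemma code_drop_encode [simp]: "code_drop k (list_encode xs) = list_encode (drop k xs)"
proof (induction k)
  case (Suc k)
  then show ?case by (simp add: code_drop_def drop_Suc tl_drop)
qed (simp add: code_drop_def)

lemma computable_code_drop:
  "computable n K \<Longrightarrow> computable n F \<Longrightarrow> computable n (\<lambda>xs. code_drop (K xs) (F xs))"
  unfolding code_drop_def by (intro computable_funpow computable_code_tl computable_var) auto

definition code_nth :: "nat \<Rightarrow> nat \<Rightarrow> nat" where
  "code_nth c k = code_hd (code_drop k c)"

lemma code_nth_encode: "k < length xs \<Longrightarrow> code_nth (list_encode xs) k = xs ! k"
  by (simp add: code_nth_def Cons_nth_drop_Suc[symmetric])

lemma le_list_encode_Cons: "x \<le> list_encode (x # xs)" "list_encode xs < list_encode (x # xs)"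
  by (simp_all add: list_encode.simps(2) le_prod_encode_1 le_prod_encode_2 le_SucI less_Suc_eq_le)

lemma length_le_list_encode: "length xs \<le> list_encode xs"
proof (induction xs)
  case (Cons x xs)
  then show ?case using le_list_encode_Cons(2)[of xs x] by simp
qed simp


text \<open>Only the empty list has code 0, so the length is the number of tails to be taken until 0
  appears.\<close>

definition code_length :: "nat \<Rightarrow> nat" where
  "code_length c = (LEAST k. code_drop k c = 0)"

lemma code_length_encode [simp]: "code_length (list_encode xs) = length xs"
  unfolding code_length_def by (rule Least_equality) auto

lemma computable_code_length:
  assumes "computable n F"
  shows "computable n (\<lambda>xs. code_length (F xs))"
proof -
  have "computable (Suc 0) (\<lambda>xs. LEAST k. code_drop k (hd xs) = 0)"
  proof (rule computable_Least)
    show "decidable (Suc (Suc 0)) (\<lambda>ys. code_drop (hd ys) (hd (tl ys)) = 0)"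
      by (intro decidable_eq computable_code_drop computable_const computable_var) auto
    fix xs :: "nat list"
    have "code_drop (length (list_decode (hd xs))) (list_encode (list_decode (hd xs))) = 0"
      by (simp del: list_decode_inverse)
    then show "\<exists>k. code_drop k (hd xs) = 0" by auto
  qed
  then show ?thesis using assms unfolding code_length_def by (rule computable_comp1)
qed

lemma computable_code_nth:
  "computable n F \<Longrightarrow> computable n K \<Longrightarrow> computable n (\<lambda>xs. code_nth (F xs) (K xs))"
  unfolding code_nth_def by (intro computable_code_hd computable_code_drop)

text \<open>The recursion prepends the entries of \<open>a\<close> to \<open>b\<close> from the last
  to the first, hence the index \<open>code_length a - Suc k\<close>.\<close>

definition code_append :: "nat \<Rightarrow> nat \<Rightarrow> nat" where
  "code_append a b =
    rec_nat b (\<lambda>k r. code_cons (code_nth a (code_length a - Suc k)) r) (code_length a)"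

lemma code_append_encode [simp]:
  "code_append (list_encode xs) (list_encode ys) = list_encode (xs @ ys)"
proof -
  let ?n = "length xs"
  have "rec_nat (list_encode ys) (\<lambda>k r. code_cons (code_nth (list_encode xs) (?n - Suc k)) r) k
      = list_encode (drop (?n - k) xs @ ys)" if "k \<le> ?n" for k
    using that
  proof (induction k)
    case (Suc k)
    then have "drop (?n - Suc k) xs = xs ! (?n - Suc k) # drop (?n - k) xs"
      by (simp add: Cons_nth_drop_Suc[symmetric] Suc_diff_Suc)
    with Suc show ?case by (simp add: code_nth_encode)
  qed simp
  from this[of ?n] show ?thesis by (simp add: code_append_def)
qed

lemma computable_code_append:
  assumes "computable n F" "computable n G"
  shows "computable n (\<lambda>xs. code_append (F xs) (G xs))"
proof -
  have "computable (Suc (Suc 0)) (\<lambda>xs. code_append (hd xs) (hd (tl xs)))"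
    unfolding code_append_def
    by (intro computable_rec computable_code_cons computable_code_nth computable_code_length
        computable_minus computable_Suc computable_var) auto
  then show ?thesis using assms by (rule computable_comp2)
qed

lemma list_encode_append_le: "list_encode xs \<le> list_encode (xs @ ys)" "list_encode ys \<le> list_encode (xs @ ys)"
proof -
  show "list_encode ys \<le> list_encode (xs @ ys)"
  proof (induction xs)
    case (Cons x xs)
    then show ?case using le_list_encode_Cons(2)[of "xs @ ys" x] by simp
  qed simp
  show "list_encode xs \<le> list_encode (xs @ ys)"
  proof (induction xs)
    case (Cons x xs)
    then show ?case by (simp add: list_encode.simps(2) prod_encode_mono)
  qed simp
qed

text \<open>The bound \<open>j \<le> c\<close> makes \<open>decidable_ex_le\<close> applicable; by
  \<open>length_le_list_encode\<close> it covers every index.\<close>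

definition code_mem :: "nat \<Rightarrow> nat \<Rightarrow> bool" where
  "code_mem w c \<longleftrightarrow> (\<exists>j\<le>c. j < code_length c \<and> code_nth c j = w)"

lemma code_mem_encode [simp]: "code_mem w (list_encode xs) \<longleftrightarrow> w \<in> set xs"
proof -
  have "(\<exists>j\<le>list_encode xs. j < length xs \<and> code_nth (list_encode xs) j = w)
      \<longleftrightarrow> (\<exists>j<length xs. xs ! j = w)"
    using length_le_list_encode[of xs] by (intro ex_cong1) (auto simp: code_nth_encode)
  then show ?thesis by (simp add: code_mem_def in_set_conv_nth)
qed

lemma decidable_code_mem:
  assumes "computable n F" "computable n G"
  shows "decidable n (\<lambda>xs. code_mem (F xs) (G xs))"
proof -
  have "decidable (Suc (Suc 0)) (\<lambda>xs. code_mem (hd xs) (hd (tl xs)))"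
    unfolding code_mem_def
    by (intro decidable_ex_le decidable_conj decidable_less decidable_eq computable_code_nth
        computable_code_length computable_var) auto
  then show ?thesis using assms by (rule decidable_comp2)
qed

lemma decidable_code_all_less:
  assumes "computable n F"
  shows "decidable n (\<lambda>xs. \<forall>x\<in>set (list_decode (F xs)). x < m)"
proof -
  have "decidable (Suc 0) (\<lambda>xs. \<forall>x\<le>hd xs. code_mem x (hd xs) \<longrightarrow> x < m)"
    by (intro decidable_all_le decidable_imp decidable_code_mem decidable_less computable_const
        computable_var) auto
  moreover have "(\<forall>x\<le>c. code_mem x c \<longrightarrow> x < m) \<longleftrightarrow> (\<forall>x\<in>set (list_decode c). x < m)" for c
  proof -
    have le: "x \<le> list_encode ws" if "x \<in> set ws" for x ws
      using that
    proof (induction ws)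
      case (Cons w ws)
      then show ?case using le_list_encode_Cons(1)[of w ws] le_list_encode_Cons(2)[of ws w] by auto
    qed simp
    define ws where "ws = list_decode c"
    have "c = list_encode ws" by (simp add: ws_def)
    then show ?thesis using le by auto
  qed
  ultimately have "decidable (Suc 0) (\<lambda>xs. \<forall>x\<in>set (list_decode (hd xs)). x < m)" by simp
  then show ?thesis using assms by (rule decidable_comp1)
qed

text \<open>The code of \<open>replicate k e\<close>. It translates a bound on the length of words
  into a bound on their codes.\<close>

definition code_bound :: "nat \<Rightarrow> nat \<Rightarrow> nat" where
  "code_bound e k = ((\<lambda>c. code_cons e c) ^^ k) 0"

lemma list_encode_le_code_bound:
  assumes "length xs \<le> k" "\<And>x. x \<in> set xs \<Longrightarrow> x \<le> e"
  shows "list_encode xs \<le> code_bound e k"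
  using assms
proof (induction xs arbitrary: k)
  case (Cons x xs)
  then obtain k' where k: "k = Suc k'" "length xs \<le> k'" by (cases k) auto
  with Cons have "list_encode xs \<le> code_bound e k'" by simp
  with Cons.prems(2) show ?case
    by (simp add: k code_bound_def code_cons_def list_encode.simps(2) prod_encode_mono)
qed simp

lemma computable_code_bound:
  assumes "computable n F" "computable n G"
  shows "computable n (\<lambda>xs. code_bound (F xs) (G xs))"
proof -
  have "computable (Suc (Suc 0)) (\<lambda>xs. code_bound (hd xs) (hd (tl xs)))"
    unfolding code_bound_def
    by (intro computable_funpow computable_code_cons computable_const computable_var) auto
  then show ?thesis using assms by (rule computable_comp2)
qed

subsection \<open>Bounded reachability\<close>

text \<open>A point is reachable iff it lies in every closed set containing the start; closed subsets of
  an initial segment are coded as lists with bounded codes.\<close>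

lemma rtranclp_iff_closed_codes:
  fixes S :: "nat \<Rightarrow> nat \<Rightarrow> bool"
  assumes "s \<le> B"
  shows "(\<lambda>w w'. S w w' \<and> w \<le> B \<and> w' \<le> B)\<^sup>*\<^sup>* s t \<longleftrightarrow>
    (\<forall>y\<le>code_bound B (Suc B). code_mem s y \<and>
      (\<forall>w\<le>B. \<forall>w'\<le>B. code_mem w y \<and> S w w' \<longrightarrow> code_mem w' y) \<longrightarrow> code_mem t y)"
    (is "?R\<^sup>*\<^sup>* s t \<longleftrightarrow> ?C")
proof
  assume R: "?R\<^sup>*\<^sup>* s t"
  show ?C
  proof (intro allI impI, elim conjE)
    fix y assume "code_mem s y" and cl: "\<forall>w\<le>B. \<forall>w'\<le>B. code_mem w y \<and> S w w' \<longrightarrow> code_mem w' y"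
    from R \<open>code_mem s y\<close> show "code_mem t y"
    proof (induction rule: rtranclp_induct)
      case (step w w')
      then show ?case using cl by blast
    qed
  qed
next
  assume C: ?C
  \<comment> \<open>The reachable set is itself closed. It has at most \<open>Suc B\<close>
    elements, none above \<open>B\<close>, so its sorted list is one of the candidates
    \<open>y\<close>.\<close>
  define A where "A = {w. w \<le> B \<and> ?R\<^sup>*\<^sup>* s w}"
  define y where "y = list_encode (sorted_list_of_set A)"
  have A: "finite A" "A \<subseteq> {..B}" by (auto simp: A_def)
  then have mem: "code_mem w y \<longleftrightarrow> w \<in> A" for w by (simp add: y_def)
  have "card A \<le> Suc B" using card_mono[OF _ A(2)] by simp
  then have "y \<le> code_bound B (Suc B)"
    unfolding y_def using A by (intro list_encode_le_code_bound) auto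
  moreover have "code_mem s y" using assms by (simp add: mem A_def)
  moreover have "code_mem w' y" if "w \<le> B" "w' \<le> B" "code_mem w y" "S w w'" for w w'
  proof -
    from that have "?R\<^sup>*\<^sup>* s w" "?R w w'" by (simp_all add: mem A_def)
    then have "?R\<^sup>*\<^sup>* s w'" by (rule rtranclp.rtrancl_into_rtrancl)
    with that show ?thesis by (simp add: mem A_def)
  qed
  ultimately have "code_mem t y" using C by blast
  then show "?R\<^sup>*\<^sup>* s t" by (simp add: mem A_def)
qed

text \<open>The data must stay computable after any substitution and for any number of variables,
  because they are used beneath the three quantifiers of the closed-set criterion.\<close>

lemma decidable_bounded_reachability:
  fixes S :: "nat \<Rightarrow> nat \<Rightarrow> bool"
  assumes S: "\<And>n F G. computable n F \<Longrightarrow> computable n G \<Longrightarrow> decidable n (\<lambda>xs. S (F xs) (G xs))"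
    and B: "\<And>n F. computable n F \<Longrightarrow> computable n (\<lambda>xs. B (F xs))"
    and s: "\<And>n F. computable n F \<Longrightarrow> computable n (\<lambda>xs. s (F xs))"
    and t: "\<And>n F. computable n F \<Longrightarrow> computable n (\<lambda>xs. t (F xs))"
    and le: "\<And>x. s x \<le> B x"
  shows "decidable 1 (\<lambda>xs. (\<lambda>w w'. S w w' \<and> w \<le> B (hd xs) \<and> w' \<le> B (hd xs))\<^sup>*\<^sup>* (s (hd xs)) (t (hd xs)))"
  unfolding rtranclp_iff_closed_codes[OF le]
  by (intro decidable_all_le decidable_imp decidable_conj decidable_code_mem S B s t
      computable_code_bound computable_Suc computable_var) auto

lemma decidable_setI:
  assumes "decidable 1 (\<lambda>xs. hd xs \<in> A)"
  shows "decidable_set A"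
proof -
  obtain f where "recfn 1 f" "\<And>xs. length xs = 1 \<Longrightarrow> f xs = (if hd xs \<in> A then 1 else 0)"
    using assms unfolding decidable_def computable_def by auto
  then show ?thesis unfolding decidable_set_def by (intro exI[of _ f]) simp
qed

section \<open>Hyperbolic metrics\<close>

locale nat_metric =
  fixes X :: "'a set" and d :: "'a \<Rightarrow> 'a \<Rightarrow> nat"
  assumes self: "x \<in> X \<Longrightarrow> d x x = 0"
    and sym: "x \<in> X \<Longrightarrow> y \<in> X \<Longrightarrow> d x y = d y x"
    and tri: "x \<in> X \<Longrightarrow> y \<in> X \<Longrightarrow> z \<in> X \<Longrightarrow> d x z \<le> d x y + d y z"
begin

definition geodesic :: "(nat \<Rightarrow> 'a) \<Rightarrow> nat \<Rightarrow> bool" where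
  "geodesic c n \<longleftrightarrow> (\<forall>i\<le>n. c i \<in> X) \<and> (\<forall>i j. i \<le> j \<longrightarrow> j \<le> n \<longrightarrow> d (c i) (c j) = j - i)"

lemma geodesic_in: "geodesic c n \<Longrightarrow> i \<le> n \<Longrightarrow> c i \<in> X"
  by (simp add: geodesic_def)

lemma geodesic_dist: "geodesic c n \<Longrightarrow> i \<le> j \<Longrightarrow> j \<le> n \<Longrightarrow> d (c i) (c j) = j - i"
  by (simp add: geodesic_def)

end

text \<open>Distances are integers, so twice the Gromov product is used.\<close>

locale hyperbolic_metric = nat_metric +
  fixes \<Delta> :: nat
  assumes four_point: "\<lbrakk>w \<in> X; x \<in> X; y \<in> X; z \<in> X\<rbrakk> \<Longrightarrow>
    d x z + d y w \<le> max (d x y + d z w) (d y z + d x w) + \<Delta>"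
begin

section \<open>Doubled Gromov products along chains and paths\<close>

definition gp :: "'a \<Rightarrow> 'a \<Rightarrow> 'a \<Rightarrow> int" where
  "gp w x y = int (d x w) + int (d y w) - int (d x y)"

lemma gp_hyperbolic:
  "\<lbrakk>w \<in> X; x \<in> X; y \<in> X; z \<in> X\<rbrakk> \<Longrightarrow> min (gp w x y) (gp w y z) - \<Delta> \<le> gp w x z"
  using four_point[of w x y z] unfolding gp_def by linarith

lemma gp_sym: "\<lbrakk>w \<in> X; x \<in> X; y \<in> X\<rbrakk> \<Longrightarrow> gp w x y = gp w y x"
  by (simp add: gp_def sym)

lemma gp_ge: "\<lbrakk>w \<in> X; x \<in> X; y \<in> X\<rbrakk> \<Longrightarrow> 2 * (int (d w x) - int (d x y)) \<le> gp w x y"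
  using tri[of x y w] sym[of w x] by (simp add: gp_def)

text \<open>Halving the chain k times costs only k times the hyperbolicity constant.\<close>

lemma gp_chain:
  assumes "w \<in> X" "\<And>i. i \<le> m \<Longrightarrow> q i \<in> X" "\<And>i. i < m \<Longrightarrow> B \<le> gp w (q i) (q (Suc i))"
    and "0 < m" "m \<le> 2 ^ k"
  shows "B - k * \<Delta> \<le> gp w (q 0) (q m)"
  using assms(2-)
proof (induction k arbitrary: q m)
  case 0
  then have "m = 1" by simp
  with 0(2)[of 0] show ?case by simp
next
  case (Suc k)
  show ?case
  proof (cases "m = 1")
    case True
    have "B - int (Suc k) * int \<Delta> \<le> B" by (simp del: of_nat_Suc)
    also have "B \<le> gp w (q 0) (q m)" using Suc.prems(2)[of 0] True by simp
    finally show ?thesis by (simp only: of_nat_mult)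
  next
    case False
    define l where "l = m div 2"
    have l: "0 < l" "l \<le> 2 ^ k" "0 < m - l" "m - l \<le> 2 ^ k" "l \<le> m"
      using False Suc.prems(3,4) by (auto simp: l_def)
    have 1: "B - k * \<Delta> \<le> gp w (q 0) (q l)"
      using l Suc.prems by (intro Suc.IH) auto
    have 2: "B - k * \<Delta> \<le> gp w (q (l + 0)) (q (l + (m - l)))"
      using l Suc.prems by (intro Suc.IH) auto
    have "min (gp w (q 0) (q l)) (gp w (q l) (q m)) - \<Delta> \<le> gp w (q 0) (q m)"
      using l Suc.prems(1) assms(1) by (intro gp_hyperbolic) auto
    with 1 2 l show ?thesis by (simp add: algebra_simps)
  qed
qed

text \<open>Neighbouring points at distance at least \<open>D\<close> from \<open>w\<close> and at
  most \<open>l\<close> from each other have doubled product at least \<open>2 * (D - l)\<close>,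
  and \<open>gp_chain\<close> loses only a logarithm of the number of steps. A path around a ball is
  thus either exponentially long or has a large product.\<close>

lemma gp_path:
  assumes w: "w \<in> X" and p: "\<And>a. a \<le> m \<Longrightarrow> p a \<in> X" "\<And>a. a < m \<Longrightarrow> d (p a) (p (Suc a)) \<le> l"
    and far: "\<And>a. a \<le> m \<Longrightarrow> D \<le> d w (p a)"
    and "a \<le> b" "b \<le> m" "b - a \<le> 2 ^ k"
  shows "2 * (int D - l) - k * \<Delta> \<le> gp w (p a) (p b)"
proof (cases "a = b")
  case True
  have "2 * (int D - l) - k * \<Delta> \<le> 2 * (int D - l)" by simp
  also have "\<dots> \<le> 2 * int (d w (p a))" using far[of b] assms(6) True by simp
  also have "\<dots> = gp w (p a) (p b)" using assms True by (simp add: gp_def self sym)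
  finally show ?thesis .
next
  case False
  have "2 * (int D - l) \<le> gp w (p (a + i)) (p (a + Suc i))" if "i < b - a" for i
  proof -
    have i: "a + i < m" using that assms(5,6) by linarith
    show ?thesis
      using gp_ge[of w "p (a + i)" "p (a + Suc i)"] far[of "a + i"] p(1)[of "a + i"]
        p(1)[of "a + Suc i"] p(2)[of "a + i"] w i by simp
  qed
  then have "2 * (int D - l) - k * \<Delta> \<le> gp w (p (a + 0)) (p (a + (b - a)))"
    using assms False by (intro gp_chain) auto
  with assms(5) show ?thesis by simp
qed

lemma gp_geodesic:
  assumes "geodesic c n" "i \<le> j" "j \<le> k" "k \<le> n"
  shows "gp (c j) (c i) (c k) = 0"
  using geodesic_dist[OF assms(1), of i j] geodesic_dist[OF assms(1), of j k]
    geodesic_dist[OF assms(1), of i k] sym[of "c k" "c j"] geodesic_in[OF assms(1)] assms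
  by (simp add: gp_def)

text \<open>The demands on \<open>k\<close> compete: \<open>2 ^ k\<close> must cover a path of
  \<open>6 * D\<close> steps, yet the loss \<open>k * \<Delta>\<close> must stay below
  \<open>2 * D\<close>. Exponential growth reconciles them once \<open>D\<close> is large.\<close>

lemma exists_log_bound: "\<exists>R. \<forall>D>R. \<exists>k. 6 * D \<le> 2 ^ k \<and> (k + 2) * \<Delta> + 2 * l < (2 * D :: nat)"
proof -
  have "eventually (\<lambda>k. 6 * (real k + 1) * (real \<Delta> + 1) \<le> 2 ^ k) sequentially"
    by real_asymp
  then obtain k0 where k0: "\<And>k. k0 \<le> k \<Longrightarrow> 6 * (real k + 1) * (real \<Delta> + 1) \<le> 2 ^ k"
    by (auto simp: eventually_at_top_linorder)
  have "6 * D \<le> 2 ^ (D div Suc \<Delta>) \<and> (D div Suc \<Delta> + 2) * \<Delta> + 2 * l < 2 * D"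
    if D: "k0 * Suc \<Delta> + 2 * \<Delta> + 2 * l < D" for D
  proof -
    \<comment> \<open>A \<open>k\<close> proportional to \<open>D\<close> suffices:
      \<open>k * \<Delta> \<le> D\<close> leaves another \<open>D\<close> for
      \<open>2 * \<Delta> + 2 * l\<close>, and \<open>2 ^ k\<close> exceeds
      \<open>6 * Suc k * Suc \<Delta>\<close>, which is at least \<open>6 * D\<close>.\<close>
    define k where "k = D div Suc \<Delta>"
    have "k0 * Suc \<Delta> \<le> D" using D by linarith
    then have "k0 \<le> k"
      unfolding k_def by (metis div_le_mono nonzero_mult_div_cancel_right nat.distinct(1))
    then have "6 * (real k + 1) * (real \<Delta> + 1) \<le> 2 ^ k" by (rule k0)
    then have "real (6 * Suc k * Suc \<Delta>) \<le> real (2 ^ k)" by (simp add: algebra_simps)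
    then have "6 * Suc k * Suc \<Delta> \<le> 2 ^ k" by (simp only: of_nat_le_iff)
    moreover have "D \<le> Suc k * Suc \<Delta>"
      unfolding k_def using dividend_less_times_div[of "Suc \<Delta>" D] by (simp add: algebra_simps)
    moreover have "k * \<Delta> \<le> D"
      using div_times_less_eq_dividend[of D "Suc \<Delta>"] unfolding k_def by (simp add: algebra_simps)
    ultimately show ?thesis using D unfolding k_def[symmetric] by (simp add: algebra_simps)
  qed
  then show ?thesis by blast
qed

text \<open>Shaped for geodesics of a larger generating set: their parameter difference is the
  distance in a smaller metric, so the lower bound carries no constants, and \<open>l\<close> bounds
  the cost of one of the additional letters.\<close>

definition quasigeodesic :: "nat \<Rightarrow> (nat \<Rightarrow> 'a) \<Rightarrow> nat \<Rightarrow> bool" where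
  "quasigeodesic l p m \<longleftrightarrow> (\<forall>a\<le>m. p a \<in> X) \<and> (\<forall>a<m. d (p a) (p (Suc a)) \<le> l) \<and>
     (\<forall>a b. a \<le> b \<longrightarrow> b \<le> m \<longrightarrow> b - a \<le> d (p a) (p b))"

text \<open>One half of the Morse lemma. Let \<open>w\<close> be a point of the geodesic farthest
  from the path, at distance \<open>D\<close>. The product at \<open>w\<close> of points on its two
  sides is 0, while a path avoiding the ball of radius \<open>D\<close> would force it to be about
  \<open>2 * D\<close> minus a logarithm of \<open>D\<close>.\<close>

lemma geodesic_near_quasigeodesic:
  obtains R where "\<And>p m c n i. \<lbrakk>quasigeodesic l p m; geodesic c n; c 0 = p 0; c n = p m; i \<le> n\<rbrakk> \<Longrightarrow>
    \<exists>a\<le>m. d (c i) (p a) \<le> R"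
proof -
  obtain R where R: "\<And>D. R < D \<Longrightarrow> \<exists>k. 6 * D \<le> 2 ^ k \<and> (k + 2) * \<Delta> + 2 * l < 2 * D"
    using exists_log_bound by metis
  show thesis
  proof (rule that[of R])
    fix p m c n i
    assume p: "quasigeodesic l p m" and c: "geodesic c n" and ends: "c 0 = p 0" "c n = p m"
      and "i \<le> n"
    have pX: "\<And>a. a \<le> m \<Longrightarrow> p a \<in> X" using p by (simp add: quasigeodesic_def)
    have cX: "\<And>i. i \<le> n \<Longrightarrow> c i \<in> X" using c by (rule geodesic_in)
    define e where "e i = Min ((\<lambda>a. d (c i) (p a)) ` {..m})" for i
    have e_le: "e i \<le> d (c i) (p a)" if "a \<le> m" for i a
      unfolding e_def using that by (intro Min_le) auto
    have e_ex: "\<exists>a\<le>m. d (c i) (p a) = e i" for i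
    proof -
      have "e i \<in> (\<lambda>a. d (c i) (p a)) ` {..m}" unfolding e_def by (intro Min_in) auto
      then show ?thesis by auto
    qed
    define D where "D = Max (e ` {..n})"
    have e_D: "e i \<le> D" if "i \<le> n" for i unfolding D_def using that by (intro Max_ge) auto
    have "D \<in> e ` {..n}" unfolding D_def by (intro Max_in) auto
    then obtain i0 where i0: "i0 \<le> n" "e i0 = D" by auto
    define w where "w = c i0"
    have w: "w \<in> X" using i0 cX by (simp add: w_def)
    have far: "D \<le> d w (p a)" if "a \<le> m" for a using e_le[OF that, of i0] i0 by (simp add: w_def)
    \<comment> \<open>At distance \<open>2 * D\<close> from \<open>w\<close> and at most
      \<open>D\<close> from the path, \<open>gp_ge\<close> gives \<open>2 * D\<close>. An end of the
      geodesic lies on the path, so it is itself at distance at least \<open>D\<close> from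
      \<open>w\<close>.\<close>
    have near: "\<exists>a\<le>m. d (c j) (p a) \<le> D \<and> 2 * int D \<le> gp w (c j) (p a)"
      if j: "j \<le> n" "j = 0 \<or> j = n \<or> d w (c j) = 2 * D" for j
    proof (cases "j = 0 \<or> j = n")
      case True
      then obtain a where a: "a \<le> m" "c j = p a" using ends by auto
      then have "gp w (c j) (p a) = 2 * int (d w (p a))"
        using pX w by (simp add: gp_def self sym)
      with a far[of a] pX show ?thesis by (intro exI[of _ a]) (simp add: self)
    next
      case False
      obtain a where a: "a \<le> m" "d (c j) (p a) = e j" using e_ex by blast
      with gp_ge[OF w cX[OF j(1)] pX[OF a(1)]] False j(2) e_D[OF j(1)] show ?thesis
        by (intro exI[of _ a]) simp
    qed
    \<comment> \<open>Walk \<open>2 * D\<close> to either side of \<open>w\<close>; truncated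
      subtraction and \<open>min\<close> stop at the ends of the geodesic.\<close>
    define i1 where "i1 = i0 - 2 * D"
    define i2 where "i2 = min n (i0 + 2 * D)"
    have i12: "i1 \<le> i0" "i0 \<le> i2" "i2 \<le> n" using i0 by (auto simp: i1_def i2_def)
    have "i1 = 0 \<or> d w (c i1) = 2 * D"
      using geodesic_dist[OF c i12(1)] i0 sym[OF w cX[of i1]] i12 by (auto simp: i1_def w_def)
    then obtain a1 where a1: "a1 \<le> m" "d (c i1) (p a1) \<le> D" "2 * int D \<le> gp w (c i1) (p a1)"
      using near[of i1] i12 i0 by auto
    have "i2 = n \<or> d w (c i2) = 2 * D"
      using geodesic_dist[OF c i12(2,3)] by (auto simp: i2_def w_def min_def)
    then obtain a2 where a2: "a2 \<le> m" "d (c i2) (p a2) \<le> D" "2 * int D \<le> gp w (c i2) (p a2)"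
      using near[of i2] i12 i0 by auto
    note X = w cX[of i1] cX[of i2] pX[OF a1(1)] pX[OF a2(1)]
    have "d (c i1) (c i2) \<le> 4 * D"
    proof -
      have "i2 \<le> i0 + 2 * D" "i0 \<le> i1 + 2 * D" by (auto simp: i1_def i2_def)
      then show ?thesis using geodesic_dist[OF c, of i1 i2] i12 by simp
    qed
    \<comment> \<open>Here \<open>6 = 1 + 4 + 1\<close>. By the lower bound of a quasigeodesic,
      \<open>6 * D\<close> also bounds the number of steps between the two path points.\<close>
    then have dp: "d (p a1) (p a2) \<le> 6 * D"
      using tri[of "p a1" "c i1" "p a2"] tri[of "c i1" "c i2" "p a2"] sym[of "p a1" "c i1"]
        a1 a2 X i12 i0 by simp
    have "D \<le> R"
    proof (rule ccontr)
      assume "\<not> D \<le> R"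
      then obtain k where k: "6 * D \<le> 2 ^ k" "(k + 2) * \<Delta> + 2 * l < 2 * D"
        using R[of D] by auto
      have len: "b - a \<le> 6 * D" if "a \<le> b" "b \<le> m" "d (p a) (p b) \<le> 6 * D" for a b
      proof -
        have "b - a \<le> d (p a) (p b)" using p that by (simp add: quasigeodesic_def)
        with that show ?thesis by simp
      qed
      define K where "K = int (k * \<Delta>)"
      have K: "0 \<le> K" by (simp add: K_def)
      have path: "2 * (int D - l) - K \<le> gp w (p a) (p b)"
        if "a \<le> b" "b \<le> m" "d (p a) (p b) \<le> 6 * D" for a b
        unfolding K_def using p that far w len[OF that] k(1)
        by (intro gp_path[where m = m]) (auto simp: quasigeodesic_def)
      \<comment> \<open>The two path points may come in reverse order.\<close>
      have "2 * (int D - l) - K \<le> gp w (p a1) (p a2)"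
      proof (cases "a1 \<le> a2")
        case True
        then show ?thesis using a2 dp by (intro path)
      next
        case False
        then show ?thesis using path[of a2 a1] dp a1 X by (simp add: gp_sym sym)
      qed
      moreover have "min (gp w (c i1) (p a1)) (gp w (p a1) (p a2)) - \<Delta> \<le> gp w (c i1) (p a2)"
        using X i12 i0 by (intro gp_hyperbolic) auto
      moreover have "min (gp w (c i1) (p a2)) (gp w (p a2) (c i2)) - \<Delta> \<le> gp w (c i1) (c i2)"
        using X i12 i0 by (intro gp_hyperbolic) auto
      moreover have "gp w (c i1) (c i2) = 0"
        unfolding w_def using c i12 by (intro gp_geodesic) auto
      moreover have "gp w (p a2) (c i2) = gp w (c i2) (p a2)"
        using X i12 by (intro gp_sym) auto
      \<comment> \<open>The chain \<open>c i1\<close>, \<open>p a1\<close>, \<open>p a2\<close>,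
        \<open>c i2\<close> costs two further \<Delta>, and its total product is 0. This contradicts
        the choice of \<open>k\<close>.\<close>
      ultimately have "2 * (int D - l) - K - 2 * \<Delta> \<le> 0"
        using K a1(3) a2(3) by (auto simp: min_def split: if_splits)
      moreover have "int ((k + 2) * \<Delta> + 2 * l) < int (2 * D)" using k(2) by (simp only: of_nat_less_iff)
      ultimately show False by (simp add: K_def algebra_simps)
    qed
    moreover obtain a where "a \<le> m" "d (c i) (p a) = e i" using e_ex by blast
    ultimately show "\<exists>a\<le>m. d (c i) (p a) \<le> R" using e_D[OF \<open>i \<le> n\<close>] by fastforce
  qed
qed

section \<open>Thin quadrilaterals and fellow travelling\<close>

text \<open>The product of the ends of \<open>c\<close> at a point of \<open>c\<close> is 0. Passing
  from one end to the other via the ends of \<open>c'\<close> makes one of three doubled products at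
  most \<open>2 * \<Delta>\<close>: the point is close to an end of \<open>c'\<close>, or lies
  almost between these ends.\<close>

lemma geodesics_near:
  assumes c: "geodesic c n" and c': "geodesic c' n'" and i: "i \<le> n"
  obtains j where "j \<le> n'" "d (c i) (c' j) \<le> d (c 0) (c' 0) + d (c n) (c' n') + 3 * \<Delta>"
proof -
  let ?w = "c i" and ?x = "c 0" and ?y = "c n" and ?x' = "c' 0" and ?y' = "c' n'"
  have X: "?w \<in> X" "?x \<in> X" "?y \<in> X" "?x' \<in> X" "?y' \<in> X"
    using geodesic_in[OF c] geodesic_in[OF c'] i by auto
  have "gp ?w ?x ?y = 0" using gp_geodesic[OF c, of 0 i n] i by simp
  moreover have "min (gp ?w ?x ?x') (gp ?w ?x' ?y) - \<Delta> \<le> gp ?w ?x ?y"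
    using X by (intro gp_hyperbolic) auto
  moreover have "min (gp ?w ?x' ?y') (gp ?w ?y' ?y) - \<Delta> \<le> gp ?w ?x' ?y"
    using X by (intro gp_hyperbolic) auto
  ultimately consider "gp ?w ?x ?x' \<le> 2 * \<Delta>" | "gp ?w ?y' ?y \<le> 2 * \<Delta>" | "gp ?w ?x' ?y' \<le> 2 * \<Delta>"
    by linarith
  then show thesis
  proof cases
    case 1
    have "2 * (int (d ?w ?x') - int (d ?x' ?x)) \<le> gp ?w ?x' ?x" using X by (intro gp_ge) auto
    with 1 X have "d ?w ?x' \<le> d ?x ?x' + \<Delta>" by (simp add: gp_sym sym)
    then show ?thesis by (intro that[of 0]) auto
  next
    case 2
    have "2 * (int (d ?w ?y') - int (d ?y' ?y)) \<le> gp ?w ?y' ?y" using X by (intro gp_ge) auto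
    with 2 X have "d ?w ?y' \<le> d ?y ?y' + \<Delta>" by (simp add: sym)
    then show ?thesis by (intro that[of n']) auto
  next
    case 3
    \<comment> \<open>The point of \<open>c'\<close> as far from the start of \<open>c'\<close> as
      \<open>?w\<close> is. If \<open>c'\<close> is too short for that, its end serves, since
      \<open>sum\<close> then places the end within \<open>2 * \<Delta>\<close> of
      \<open>?w\<close>.\<close>
    define j where "j = min (d ?w ?x') n'"
    have j: "j \<le> n'" by (simp add: j_def)
    have jX: "c' j \<in> X" using geodesic_in[OF c' j] .
    have n': "d ?x' ?y' = n'" "d (c' j) ?y' = n' - j" "d ?x' (c' j) = j"
      using geodesic_dist[OF c'] j by auto
    have sum: "d ?w ?x' + d ?w ?y' \<le> n' + 2 * \<Delta>"
      using 3 n' X by (simp add: gp_def sym)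
    have "d ?w (c' j) \<le> 3 * \<Delta>"
    proof (cases "d ?w ?x' \<le> n'")
      case True
      have "d ?x' ?y' + d (c' j) ?w \<le> max (d ?x' (c' j) + d ?y' ?w) (d (c' j) ?y' + d ?x' ?w) + \<Delta>"
        using X jX by (intro four_point) auto
      with True n' sum X jX show ?thesis by (simp add: j_def sym)
    next
      case False
      with sum show ?thesis by (simp add: j_def)
    qed
    then show ?thesis using j by (intro that[of j]) auto
  qed
qed

text \<open>Seen from the common start, two points of one geodesic have doubled product twice the
  smaller parameter. Two uses of hyperbolicity, via the two ends, compare \<open>c t\<close> with
  the point of \<open>c'\<close> at the same time, or with its end if \<open>c'\<close> has already
  stopped.\<close>

lemma geodesics_fellow_travel:
  assumes c: "geodesic c n" and c': "geodesic c' n'" and "c 0 = c' 0" and t: "t \<le> n"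
  shows "d (c t) (c' (min t n')) \<le> d (c n) (c' n') + 2 * \<Delta>"
proof -
  let ?o = "c 0" and ?s = "min t n'"
  have X: "?o \<in> X" "c t \<in> X" "c n \<in> X" "c' n' \<in> X" "c' ?s \<in> X"
    using geodesic_in[OF c] geodesic_in[OF c'] t by auto
  have ds: "d ?o (c t) = t" "d (c t) (c n) = n - t" "d ?o (c n) = n"
    "d ?o (c' n') = n'" "d ?o (c' ?s) = ?s" "d (c' ?s) (c' n') = n' - ?s"
    using geodesic_dist[OF c, of 0 t] geodesic_dist[OF c, of 0 n] geodesic_dist[OF c, of t n]
      geodesic_dist[OF c', of 0 n'] geodesic_dist[OF c', of 0 ?s] geodesic_dist[OF c', of ?s n'] assms(3) t
    by simp_all
  have "min (gp ?o (c t) (c n)) (gp ?o (c n) (c' n')) - \<Delta> \<le> gp ?o (c t) (c' n')"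
    "min (gp ?o (c t) (c' n')) (gp ?o (c' n') (c' ?s)) - \<Delta> \<le> gp ?o (c t) (c' ?s)"
    using X by (auto intro!: gp_hyperbolic)
  moreover have "gp ?o (c t) (c n) = 2 * t" "gp ?o (c' n') (c' ?s) = 2 * ?s"
    "gp ?o (c t) (c' ?s) = t + ?s - int (d (c t) (c' ?s))"
    "gp ?o (c n) (c' n') = n + n' - int (d (c n) (c' n'))"
    using ds X t sym[of ?o] sym[of "c' n'" "c' ?s"] by (auto simp: gp_def)
  moreover have "n \<le> d (c n) (c' n') + n'"
    using tri[of ?o "c' n'" "c n"] X ds sym[of "c n" "c' n'"] by simp
  ultimately show ?thesis using t by linarith
qed

end

text \<open>Along a geodesic for the invariant metric an isometry displaces points by a bounded amount plus
  the displacements of the ends; a geodesic for the hyperbolic metric stays near such a path.\<close>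

lemma (in hyperbolic_metric) isometry_displacement_on_geodesic:
  assumes "nat_metric X d'"
    and lip: "\<And>x y. x \<in> X \<Longrightarrow> y \<in> X \<Longrightarrow> d' x y \<le> d x y" "\<And>x y. x \<in> X \<Longrightarrow> y \<in> X \<Longrightarrow> d x y \<le> l * d' x y"
  obtains C where "\<And>\<psi> p m c n c' n' i.
    \<lbrakk>\<And>x. x \<in> X \<Longrightarrow> \<psi> x \<in> X; \<And>x y. x \<in> X \<Longrightarrow> y \<in> X \<Longrightarrow> d' (\<psi> x) (\<psi> y) = d' x y;
     nat_metric.geodesic X d' p m; geodesic c n; geodesic c' n'; c 0 = p 0; c n = p m;
     c' 0 = \<psi> (p 0); c' n' = \<psi> (p m); i \<le> n\<rbrakk>
    \<Longrightarrow> d (c i) (\<psi> (c i)) \<le> C * (d (p 0) (\<psi> (p 0)) + d (p m) (\<psi> (p m)) + 1)"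
proof -
  interpret M: nat_metric X d' by fact
  obtain R where R: "\<And>p m c n i. \<lbrakk>quasigeodesic l p m; geodesic c n; c 0 = p 0; c n = p m; i \<le> n\<rbrakk> \<Longrightarrow>
    \<exists>a\<le>m. d (c i) (p a) \<le> R"
    by (rule geodesic_near_quasigeodesic[of l]) (rule that)
  have quasi: "quasigeodesic l p m" if p: "M.geodesic p m" for p m
    unfolding quasigeodesic_def
  proof (intro conjI allI impI)
    show "p a \<in> X" if "a \<le> m" for a using M.geodesic_in[OF p that] .
    show "d (p a) (p (Suc a)) \<le> l" if "a < m" for a
      using lip(2)[of "p a" "p (Suc a)"] M.geodesic_in[OF p] M.geodesic_dist[OF p, of a "Suc a"] that
      by simp
    show "b - a \<le> d (p a) (p b)" if "a \<le> b" "b \<le> m" for a b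
      using lip(1)[of "p a" "p b"] M.geodesic_in[OF p] M.geodesic_dist[OF p that] that by simp
  qed
  show thesis
  \<comment> \<open>In the metric \<open>d'\<close> the estimate is
    \<open>4 * R + 3 * E + 6 * \<Delta>\<close>, with \<open>E\<close> the sum of the end
    displacements. The factor \<open>E + 1\<close> absorbs it, and \<open>l\<close> converts it to
    \<open>d\<close>.\<close>
  proof (rule that[of "l * (4 * R + 6 * \<Delta> + 3)"])
    fix \<psi> p m c n c' n' i
    assume \<psi>: "\<And>x. x \<in> X \<Longrightarrow> \<psi> x \<in> X" and iso: "\<And>x y. x \<in> X \<Longrightarrow> y \<in> X \<Longrightarrow> d' (\<psi> x) (\<psi> y) = d' x y"
      and p: "M.geodesic p m" and c: "geodesic c n" and c': "geodesic c' n'"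
      and ends: "c 0 = p 0" "c n = p m" "c' 0 = \<psi> (p 0)" "c' n' = \<psi> (p m)" and i: "i \<le> n"
    define E where "E = d (p 0) (\<psi> (p 0)) + d (p m) (\<psi> (p m))"
    \<comment> \<open>The image path is again a \<open>d'\<close>-geodesic, so the stability bound
      \<open>R\<close> applies to it and to \<open>c'\<close> as well.\<close>
    have \<psi>p: "M.geodesic (\<lambda>a. \<psi> (p a)) m"
      unfolding M.geodesic_def using M.geodesic_in[OF p] M.geodesic_dist[OF p] by (auto simp: \<psi> iso)
    obtain a where a: "a \<le> m" "d (c i) (p a) \<le> R"
      using R[OF quasi[OF p] c] ends i by blast
    obtain j where j: "j \<le> n'" "d (c i) (c' j) \<le> E + 3 * \<Delta>"
      using geodesics_near[OF c c' i] ends unfolding E_def by metis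
    obtain b where b: "b \<le> m" "d (c' j) (\<psi> (p b)) \<le> R"
      using R[OF quasi[OF \<psi>p] c'] ends j by blast
    have X: "c i \<in> X" "p a \<in> X" "p b \<in> X" "p 0 \<in> X" "c' j \<in> X"
      using geodesic_in[OF c i] geodesic_in[OF c' j(1)] M.geodesic_in[OF p] a b by auto
    note X = X X[THEN \<psi>]
    have 1: "d (c i) (\<psi> (p b)) \<le> R + E + 3 * \<Delta>"
      using tri[of "c i" "c' j" "\<psi> (p b)"] X j b by simp
    then have "d (p a) (\<psi> (p b)) \<le> 2 * R + E + 3 * \<Delta>"
      using tri[of "p a" "c i" "\<psi> (p b)"] sym[of "p a" "c i"] X a by simp
    with lip(1) X have 2: "d' (p a) (\<psi> (p b)) \<le> 2 * R + E + 3 * \<Delta>" by (meson order_trans)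
    have 0: "d' (p 0) (\<psi> (p 0)) \<le> E" using lip(1)[of "p 0" "\<psi> (p 0)"] X by (simp add: E_def)
    \<comment> \<open>The parameters \<open>a\<close> and \<open>b\<close> are exact
      \<open>d'\<close>-distances from \<open>p 0\<close> and \<open>\<psi> (p 0)\<close>. As these
      starts and the points \<open>p a\<close>, \<open>\<psi> (p b)\<close> are close,
      \<open>a\<close> and \<open>b\<close> differ little, so \<open>\<psi> (p a)\<close> is close
      to \<open>\<psi> (p b)\<close> too.\<close>
    have "d' (p 0) (p a) = a" "d' (\<psi> (p 0)) (\<psi> (p b)) = b"
      using M.geodesic_dist[OF p] M.geodesic_dist[OF \<psi>p] a b by auto
    then have "a \<le> b + (2 * R + 2 * E + 3 * \<Delta>)" "b \<le> a + (2 * R + 2 * E + 3 * \<Delta>)"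
      using M.tri[of "p 0" "\<psi> (p 0)" "p a"] M.tri[of "\<psi> (p 0)" "\<psi> (p b)" "p a"]
        M.tri[of "\<psi> (p 0)" "p 0" "\<psi> (p b)"] M.tri[of "p 0" "p a" "\<psi> (p b)"]
        M.sym[of "p 0" "\<psi> (p 0)"] M.sym[of "p a" "\<psi> (p b)"] X 0 2 by simp_all
    moreover have "d' (\<psi> (p b)) (\<psi> (p a)) = (if a \<le> b then b - a else a - b)"
      using M.geodesic_dist[OF p, of a b] M.geodesic_dist[OF p, of b a] M.sym[of "p a" "p b"] a b X
      by (simp add: iso)
    ultimately have 3: "d' (\<psi> (p b)) (\<psi> (p a)) \<le> 2 * R + 2 * E + 3 * \<Delta>" by auto
    have 4: "d' (\<psi> (p a)) (\<psi> (c i)) \<le> R"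
      using lip(1)[of "c i" "p a"] X a by (simp add: iso M.sym)
    have "d' (c i) (\<psi> (p b)) \<le> R + E + 3 * \<Delta>" using lip(1) X 1 by (meson order_trans)
    then have "d' (c i) (\<psi> (c i)) \<le> 4 * R + 3 * E + 6 * \<Delta>"
      using M.tri[of "c i" "\<psi> (p b)" "\<psi> (c i)"] M.tri[of "\<psi> (p b)" "\<psi> (p a)" "\<psi> (c i)"] X 3 4 by simp
    also have "\<dots> \<le> (4 * R + 6 * \<Delta> + 3) * (E + 1)" by (simp add: algebra_simps)
    finally have "l * d' (c i) (\<psi> (c i)) \<le> l * ((4 * R + 6 * \<Delta> + 3) * (E + 1))" by simp
    with lip(2)[of "c i" "\<psi> (c i)"] X
    have "d (c i) (\<psi> (c i)) \<le> l * ((4 * R + 6 * \<Delta> + 3) * (E + 1))" by (meson order_trans)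
    then show "d (c i) (\<psi> (c i)) \<le> l * (4 * R + 6 * \<Delta> + 3) * (d (p 0) (\<psi> (p 0)) + d (p m) (\<psi> (p m)) + 1)"
      unfolding E_def[symmetric] by (simp only: mult.assoc)
  qed
qed

section \<open>Word metrics\<close>

definition gprod :: "('g, 'm) monoid_scheme \<Rightarrow> 'g list \<Rightarrow> 'g" where
  "gprod G ws = foldr (\<lambda>x y. x \<otimes>\<^bsub>G\<^esub> y) ws \<one>\<^bsub>G\<^esub>"

text \<open>Words are lists of group elements from a set instead of numbered letters, so that the
  same notion serves the given generators and the enlarged set.\<close>

definition wlen :: "('g, 'm) monoid_scheme \<Rightarrow> 'g set \<Rightarrow> 'g \<Rightarrow> nat" where
  "wlen G T x = (LEAST n. \<exists>ws. set ws \<subseteq> T \<and> length ws = n \<and> gprod G ws = x)"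

definition wdist :: "('g, 'm) monoid_scheme \<Rightarrow> 'g set \<Rightarrow> 'g \<Rightarrow> 'g \<Rightarrow> nat" where
  "wdist G T x y = wlen G T (inv\<^bsub>G\<^esub> x \<otimes>\<^bsub>G\<^esub> y)"

lemma gprod_Nil [simp]: "gprod G [] = \<one>\<^bsub>G\<^esub>"
  by (simp add: gprod_def)

lemma gprod_Cons [simp]: "gprod G (x # ws) = x \<otimes>\<^bsub>G\<^esub> gprod G ws"
  by (simp add: gprod_def)

context group
begin

lemma gprod_closed: "set ws \<subseteq> carrier G \<Longrightarrow> gprod G ws \<in> carrier G"
  by (induction ws) auto

lemma gprod_append:
  "set ws \<subseteq> carrier G \<Longrightarrow> set vs \<subseteq> carrier G \<Longrightarrow> gprod G (ws @ vs) = gprod G ws \<otimes> gprod G vs"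
  by (induction ws) (auto simp: gprod_closed m_assoc)

lemma gprod_rev_inv:
  "set ws \<subseteq> carrier G \<Longrightarrow> gprod G (map (m_inv G) (rev ws)) = inv (gprod G ws)"
proof (induction ws)
  case (Cons x ws)
  have "gprod G (map (m_inv G) (rev (x # ws))) = gprod G (map (m_inv G) (rev ws)) \<otimes> gprod G [inv x]"
    using Cons.prems by (simp only: rev.simps map_append) (subst gprod_append; auto)
  with Cons show ?case by (simp add: inv_mult_group gprod_closed)
qed simp

lemma inv_mult_telescope:
  assumes "x \<in> carrier G" "y \<in> carrier G" "z \<in> carrier G"
  shows "(inv x \<otimes> y) \<otimes> (inv y \<otimes> z) = inv x \<otimes> z"
proof -
  have "(inv x \<otimes> y) \<otimes> (inv y \<otimes> z) = inv x \<otimes> ((y \<otimes> inv y) \<otimes> z)"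
    using assms by (simp only: m_assoc inv_closed m_closed)
  with assms show ?thesis by simp
qed

lemma inv_mult_left_cancel:
  assumes "g \<in> carrier G" "x \<in> carrier G" "y \<in> carrier G"
  shows "inv (g \<otimes> x) \<otimes> (g \<otimes> y) = inv x \<otimes> y"
proof -
  have "inv (g \<otimes> x) \<otimes> (g \<otimes> y) = inv x \<otimes> ((inv g \<otimes> g) \<otimes> y)"
    using assms by (simp only: m_assoc inv_closed m_closed inv_mult_group)
  with assms show ?thesis by simp
qed

lemma hom_gprod:
  assumes "\<phi> \<in> hom G G" "set ws \<subseteq> carrier G"
  shows "\<phi> (gprod G ws) = gprod G (map \<phi> ws)"
  using assms(2)
proof (induction ws)
  case Nil
  show ?case using hom_one[OF assms(1)] is_group by simp
qed (use assms(1) in \<open>auto simp: hom_mult gprod_closed\<close>)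

end

locale generated_group = group G for G (structure) +
  fixes T
  assumes T_carrier: "T \<subseteq> carrier G" and T_inv: "t \<in> T \<Longrightarrow> inv t \<in> T"
    and T_generates: "x \<in> carrier G \<Longrightarrow> \<exists>ws. set ws \<subseteq> T \<and> gprod G ws = x"
begin

lemma wlen_word:
  assumes "x \<in> carrier G"
  obtains ws where "set ws \<subseteq> T" "length ws = wlen G T x" "gprod G ws = x"
proof -
  let ?P = "\<lambda>n. \<exists>ws. set ws \<subseteq> T \<and> length ws = n \<and> gprod G ws = x"
  have "\<exists>n. ?P n" using T_generates[OF assms] by blast
  then have "?P (wlen G T x)" unfolding wlen_def by (rule LeastI_ex)
  with that show thesis by blast
qed

lemma wlen_gprod_le: "set ws \<subseteq> T \<Longrightarrow> wlen G T (gprod G ws) \<le> length ws"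
  unfolding wlen_def by (rule Least_le) (rule exI[of _ ws], simp)

lemma wlen_one: "wlen G T \<one> = 0"
  using wlen_gprod_le[of "[]"] by simp

lemma wlen_mult_le:
  assumes "x \<in> carrier G" "y \<in> carrier G"
  shows "wlen G T (x \<otimes> y) \<le> wlen G T x + wlen G T y"
proof -
  obtain ws vs where "set ws \<subseteq> T" "length ws = wlen G T x" "gprod G ws = x"
    "set vs \<subseteq> T" "length vs = wlen G T y" "gprod G vs = y"
    using assms wlen_word by metis
  then show ?thesis using wlen_gprod_le[of "ws @ vs"] T_carrier gprod_append[of ws vs] by auto
qed

lemma wlen_inv:
  assumes "x \<in> carrier G"
  shows "wlen G T (inv x) = wlen G T x"
proof -
  have le: "wlen G T (inv x) \<le> wlen G T x" if x: "x \<in> carrier G" for x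
  proof -
    obtain ws where ws: "set ws \<subseteq> T" "length ws = wlen G T x" "gprod G ws = x"
      using x by (rule wlen_word)
    then have "wlen G T (gprod G (map (m_inv G) (rev ws))) \<le> length ws"
      using wlen_gprod_le[of "map (m_inv G) (rev ws)"] T_inv by auto
    with ws T_carrier show ?thesis by (simp only: gprod_rev_inv subset_trans)
  qed
  from le[OF assms] le[of "inv x"] assms show ?thesis by simp
qed

lemma metric: "nat_metric (carrier G) (wdist G T)"
proof
  fix x y z assume x: "x \<in> carrier G" and y: "y \<in> carrier G"
  show "wdist G T x x = 0" using x by (simp add: wdist_def wlen_one)
  show "wdist G T x y = wdist G T y x"
    using wlen_inv[of "inv x \<otimes> y"] x y by (simp add: wdist_def inv_mult_group)
  assume z: "z \<in> carrier G"
  show "wdist G T x z \<le> wdist G T x y + wdist G T y z"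
    using wlen_mult_le[of "inv x \<otimes> y" "inv y \<otimes> z"] x y z by (simp add: wdist_def inv_mult_telescope)
qed

sublocale M: nat_metric "carrier G" "wdist G T" by (rule metric)

text \<open>A subword of a shortest word is shortest: after cutting the word into three,
  subadditivity leaves no room for a shorter middle piece.\<close>

lemma geodesic_word:
  assumes ws: "set ws \<subseteq> T" "length ws = wlen G T (gprod G ws)" and g: "g \<in> carrier G"
  shows "M.geodesic (\<lambda>i. g \<otimes> gprod G (take i ws)) (length ws)"
proof -
  have sub: "set (take i ws) \<subseteq> T" "set (drop i ws) \<subseteq> T" for i
    using ws(1) set_take_subset set_drop_subset by fast+
  then have subc: "set (take i ws) \<subseteq> carrier G" "set (drop i ws) \<subseteq> carrier G" for i
    using T_carrier by blast+
  note cl = subc[THEN gprod_closed]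
  have "wdist G T (g \<otimes> gprod G (take i ws)) (g \<otimes> gprod G (take j ws)) = j - i"
    if ij: "i \<le> j" "j \<le> length ws" for i j
  proof -
    define m where "m = take (j - i) (drop i ws)"
    have m: "set m \<subseteq> T" unfolding m_def using sub set_take_subset by fast
    then have mc: "gprod G m \<in> carrier G" using T_carrier by (intro gprod_closed) auto
    have j: "take j ws = take i ws @ m" unfolding m_def using ij take_add[of i "j - i" ws] by simp
    have "gprod G (take j ws) = gprod G (take i ws) \<otimes> gprod G m"
      unfolding j using subc m T_carrier by (intro gprod_append) auto
    then have "inv (g \<otimes> gprod G (take i ws)) \<otimes> (g \<otimes> gprod G (take j ws)) = gprod G m"
      using g cl mc by (simp add: inv_mult_left_cancel) (simp add: m_assoc[symmetric])
    then have d: "wdist G T (g \<otimes> gprod G (take i ws)) (g \<otimes> gprod G (take j ws)) = wlen G T (gprod G m)"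
      by (simp add: wdist_def)
    have "wlen G T (gprod G m) \<le> j - i"
      using wlen_gprod_le[OF m] ij by (simp add: m_def)
    moreover have "j - i \<le> wlen G T (gprod G m)"
    proof -
      have "ws = take i ws @ (m @ drop j ws)"
        using j by (metis append_assoc append_take_drop_id)
      then have "gprod G ws = gprod G (take i ws @ (m @ drop j ws))" by (rule arg_cong)
      also have "\<dots> = gprod G (take i ws) \<otimes> gprod G (m @ drop j ws)"
        using subc m T_carrier by (intro gprod_append) auto
      also have "gprod G (m @ drop j ws) = gprod G m \<otimes> gprod G (drop j ws)"
        using subc m T_carrier by (intro gprod_append) auto
      finally have "length ws = wlen G T (gprod G (take i ws) \<otimes> (gprod G m \<otimes> gprod G (drop j ws)))"
        by (simp only: ws(2))
      also have "\<dots> \<le> wlen G T (gprod G (take i ws)) + wlen G T (gprod G m \<otimes> gprod G (drop j ws))"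
        by (intro wlen_mult_le m_closed cl mc)
      also have "\<dots> \<le> wlen G T (gprod G (take i ws)) + (wlen G T (gprod G m) + wlen G T (gprod G (drop j ws)))"
        by (intro add_left_mono wlen_mult_le cl mc)
      finally have "length ws \<le> wlen G T (gprod G (take i ws)) +
        (wlen G T (gprod G m) + wlen G T (gprod G (drop j ws)))" .
      with wlen_gprod_le[OF sub(1)[of i]] wlen_gprod_le[OF sub(2)[of j]] ij show ?thesis by simp
    qed
    ultimately show ?thesis using d by simp
  qed
  then show ?thesis using g cl unfolding M.geodesic_def by simp
qed

lemma exists_geodesic:
  assumes "x \<in> carrier G" "y \<in> carrier G"
  obtains c n where "M.geodesic c n" "c 0 = x" "c n = y"
proof -
  obtain ws where ws: "set ws \<subseteq> T" "length ws = wlen G T (inv x \<otimes> y)" "gprod G ws = inv x \<otimes> y"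
    using wlen_word[of "inv x \<otimes> y"] assms by blast
  then have "M.geodesic (\<lambda>i. x \<otimes> gprod G (take i ws)) (length ws)"
    using assms by (intro geodesic_word) simp_all
  with assms ws(3) show thesis
    by (intro that[of "\<lambda>i. x \<otimes> gprod G (take i ws)" "length ws"]) (auto simp: m_assoc[symmetric])
qed

end

section \<open>Changing the generating set\<close>

lemma (in generated_group) wlen_antimono:
  assumes "generated_group G T'" "T \<subseteq> T'" "x \<in> carrier G"
  shows "wlen G T' x \<le> wlen G T x"
proof -
  interpret T': generated_group G T' by fact
  obtain ws where "set ws \<subseteq> T" "length ws = wlen G T x" "gprod G ws = x"
    using assms(3) by (rule wlen_word)
  with T'.wlen_gprod_le[of ws] assms(2) show ?thesis by auto
qed

text \<open>Spell every letter of \<open>T'\<close> in letters of \<open>T\<close>; the longest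
  spelling gives \<open>l\<close>.\<close>

lemma (in generated_group) wlen_bilipschitz:
  assumes "generated_group G T'" "finite T'"
  obtains l where "\<And>x. x \<in> carrier G \<Longrightarrow> wlen G T x \<le> l * wlen G T' x"
proof -
  interpret T': generated_group G T' by fact
  \<comment> \<open>\<open>insert 0\<close> covers an empty \<open>T'\<close>.\<close>
  define l where "l = Max (insert 0 (wlen G T ` T'))"
  have l: "wlen G T t \<le> l" if "t \<in> T'" for t
    unfolding l_def using assms(2) that by (intro Max_ge) auto
  have "wlen G T (gprod G ws) \<le> l * length ws" if "set ws \<subseteq> T'" for ws
    using that
  proof (induction ws)
    case (Cons t ws)
    then have "t \<in> carrier G" "gprod G ws \<in> carrier G"
      using T'.T_carrier gprod_closed[of ws] by auto
    then have "wlen G T (gprod G (t # ws)) \<le> wlen G T t + wlen G T (gprod G ws)"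
      by (simp add: wlen_mult_le)
    also have "\<dots> \<le> l + l * length ws" using Cons l by (intro add_mono) auto
    finally show ?case by simp
  qed (simp add: wlen_one)
  note len = this
  show thesis
  proof (rule that)
    fix x assume "x \<in> carrier G"
    then obtain ws where "set ws \<subseteq> T'" "length ws = wlen G T' x" "gprod G ws = x"
      by (rule T'.wlen_word)
    with len[of ws] show "wlen G T x \<le> l * wlen G T' x" by simp
  qed
qed

text \<open>The union of the images of \<open>T\<close> under the first \<open>N\<close> powers of
  \<phi> is mapped into itself, the last image returning to \<open>T\<close>. So \<phi> does not
  increase length, and neither does its inverse, which is a power of \<phi>.\<close>

lemma (in generated_group) invariant_generators:
  assumes \<phi>: "\<phi> \<in> hom G G" and N: "0 < N" "\<And>x. x \<in> carrier G \<Longrightarrow> (\<phi> ^^ N) x = x"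
    and fin: "finite T"
  obtains T' where "generated_group G T'" "T \<subseteq> T'" "finite T'"
    "\<And>x. x \<in> carrier G \<Longrightarrow> wlen G T' (\<phi> x) = wlen G T' x"
proof -
  interpret \<phi>: group_hom G G \<phi> using \<phi> by (simp add: group_hom_def group_hom_axioms_def is_group)
  define T' where "T' = (\<Union>k<N. (\<phi> ^^ k) ` T)"
  have cl: "(\<phi> ^^ k) x \<in> carrier G" if "x \<in> carrier G" for k x
    using that by (induction k) auto
  have inv: "(\<phi> ^^ k) (inv x) = inv ((\<phi> ^^ k) x)" if "x \<in> carrier G" for k x
    using that cl by (induction k) auto
  have sub: "T \<subseteq> T'" using N(1) by (force simp: T'_def)
  have gen: "generated_group G T'"
  proof
    show "T' \<subseteq> carrier G" using cl T_carrier by (auto simp: T'_def)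
    show "inv t \<in> T'" if "t \<in> T'" for t
    proof -
      obtain k s where k: "k < N" "s \<in> T" "t = (\<phi> ^^ k) s" using \<open>t \<in> T'\<close> by (auto simp: T'_def)
      then have "inv t = (\<phi> ^^ k) (inv s)" "inv s \<in> T" using inv[of s k] T_carrier T_inv by auto
      with k(1) show ?thesis unfolding T'_def by blast
    qed
    show "\<exists>ws. set ws \<subseteq> T' \<and> gprod G ws = x" if "x \<in> carrier G" for x
      using T_generates[OF that] sub by blast
  qed
  interpret T': generated_group G T' by (rule gen)
  have \<phi>T': "\<phi> t \<in> T'" if t: "t \<in> T'" for t
  proof -
    obtain k s where k: "k < N" "s \<in> T" "t = (\<phi> ^^ k) s" using t by (auto simp: T'_def)
    show ?thesis
    proof (cases "Suc k = N")
      case True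
      then have "\<phi> t = s" using N(2)[of s] k T_carrier by auto
      with k sub show ?thesis by auto
    next
      case False
      then have "Suc k < N" "\<phi> t = (\<phi> ^^ Suc k) s" using k by auto
      with k(2) show ?thesis unfolding T'_def by blast
    qed
  qed
  have le: "wlen G T' (\<phi> x) \<le> wlen G T' x" if x: "x \<in> carrier G" for x
  proof -
    obtain ws where ws: "set ws \<subseteq> T'" "length ws = wlen G T' x" "gprod G ws = x"
      using x by (rule T'.wlen_word)
    then have "gprod G (map \<phi> ws) = \<phi> x" using hom_gprod[OF \<phi>, of ws] T'.T_carrier by auto
    with ws T'.wlen_gprod_le[of "map \<phi> ws"] \<phi>T' show ?thesis by auto
  qed
  have le': "wlen G T' ((\<phi> ^^ k) x) \<le> wlen G T' x" if "x \<in> carrier G" for x k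
  proof (induction k)
    case (Suc k)
    then show ?case using le[OF cl[OF that, of k]] by simp
  qed simp
  show thesis
  proof (rule that[OF gen sub])
    show "finite T'" using fin by (simp add: T'_def)
    fix x assume x: "x \<in> carrier G"
    \<comment> \<open>The power \<open>N - 1\<close> inverts \<phi>, which yields the opposite
      inequality.\<close>
    have "x = (\<phi> ^^ (N - 1)) (\<phi> x)"
      using N x by (cases N) (auto simp: funpow_swap1)
    then have "wlen G T' x \<le> wlen G T' (\<phi> x)" using le'[of "\<phi> x" "N - 1"] x by simp
    with le[OF x] show "wlen G T' (\<phi> x) = wlen G T' x" by simp
  qed
qed

section \<open>Twisted conjugacy\<close>

definition inverse_letter :: "nat \<Rightarrow> nat" where
  "inverse_letter k = (if even k then Suc k else k - 1)"

lemma (in group) letter_val_inverse: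
  assumes "set gens \<subseteq> carrier G" "k < 2 * length gens"
  shows "inverse_letter k < 2 * length gens" "letter_val G gens (inverse_letter k) = inv (letter_val G gens k)"
proof -
  have gen: "gens ! (k div 2) \<in> carrier G"
    using assms by (auto simp: subset_iff)
  have "inverse_letter k < 2 * length gens \<and> letter_val G gens (inverse_letter k) = inv (letter_val G gens k)"
  proof (cases "even k")
    case True
    then have "Suc k < 2 * length gens" using assms(2) by presburger
    with True show ?thesis by (simp add: letter_val_def inverse_letter_def)
  next
    case False
    then obtain m where "k = Suc (2 * m)" by (elim oddE) simp
    with assms gen show ?thesis by (simp add: letter_val_def inverse_letter_def)
  qed
  then show "inverse_letter k < 2 * length gens" "letter_val G gens (inverse_letter k) = inv (letter_val G gens k)"
    by auto
qed

lemma (in group) generated_by_letters: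
  assumes "generates G gens"
  shows "generated_group G (letter_val G gens ` {..<2 * length gens})"
proof
  let ?T = "letter_val G gens ` {..<2 * length gens}"
  have gens: "set gens \<subseteq> carrier G" using assms by (simp add: generates_def)
  then show "?T \<subseteq> carrier G" by (auto simp: letter_val_def subset_iff)
  show "inv t \<in> ?T" if "t \<in> ?T" for t
    using that letter_val_inverse[OF gens] by (auto simp flip: letter_val_inverse(2)[OF gens])
  show "\<exists>ws. set ws \<subseteq> ?T \<and> gprod G ws = x" if "x \<in> carrier G" for x
  proof -
    obtain w where "valid_word gens w" "word_eval G gens w = x"
      using assms \<open>x \<in> carrier G\<close> unfolding generates_def by blast
    then show ?thesis
      by (intro exI[of _ "map (letter_val G gens) w"])
        (auto simp: valid_word_def word_eval_def gprod_def foldr_map comp_def)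
  qed
qed

locale word_group = group G for G (structure) +
  fixes gens
  assumes generates: "generates G gens"
begin

abbreviation "T \<equiv> letter_val G gens ` {..<2 * length gens}"

sublocale generated_group G T
  by (rule generated_by_letters[OF generates])

abbreviation "valid \<equiv> valid_word gens"
abbreviation "eval \<equiv> word_eval G gens"

lemma eval_gprod: "eval w = gprod G (map (letter_val G gens) w)"
  by (simp add: word_eval_def gprod_def foldr_map comp_def)

lemma valid_letters: "valid w \<Longrightarrow> set (map (letter_val G gens) w) \<subseteq> T"
  by (auto simp: valid_word_def)

lemma valid_carrier: "valid w \<Longrightarrow> set (map (letter_val G gens) w) \<subseteq> carrier G"
  using valid_letters T_carrier by blast

lemma valid_simps [simp]:
  "valid []" "valid (k # w) \<longleftrightarrow> k < 2 * length gens \<and> valid w" "valid (u @ w) \<longleftrightarrow> valid u \<and> valid w"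
  by (auto simp: valid_word_def)

lemma valid_take [simp]: "valid w \<Longrightarrow> valid (take i w)"
  and valid_drop [simp]: "valid w \<Longrightarrow> valid (drop i w)"
  by (auto simp: valid_word_def dest: in_set_takeD in_set_dropD)

lemma eval_closed [simp]: "valid w \<Longrightarrow> eval w \<in> carrier G"
  unfolding eval_gprod using valid_carrier by (rule gprod_closed)

lemma eval_append: "valid u \<Longrightarrow> valid w \<Longrightarrow> eval (u @ w) = eval u \<otimes> eval w"
  unfolding eval_gprod map_append using valid_carrier by (intro gprod_append)

lemma letter_closed [simp]: "k < 2 * length gens \<Longrightarrow> letter_val G gens k \<in> carrier G"
  using T_carrier by blast

lemma eval_Cons [simp]: "eval (k # w) = letter_val G gens k \<otimes> eval w"
  by (simp add: eval_gprod)

lemma eval_Nil [simp]: "eval [] = \<one>"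
  by (simp add: eval_gprod)

lemma wlen_eval_le: "valid w \<Longrightarrow> wlen G T (eval w) \<le> length w"
  unfolding eval_gprod using wlen_gprod_le[OF valid_letters] by simp

lemma geodesic_word_exists:
  assumes "x \<in> carrier G"
  shows "\<exists>w. valid w \<and> eval w = x \<and> length w = wlen G T x"
proof -
  obtain ws where ws: "set ws \<subseteq> T" "length ws = wlen G T x" "gprod G ws = x"
    using assms by (rule wlen_word)
  then have "ws \<in> lists (letter_val G gens ` {..<2 * length gens})" by auto
  then obtain w where "w \<in> lists {..<2 * length gens}" "ws = map (letter_val G gens) w"
    by (auto simp: lists_image)
  with ws show ?thesis by (intro exI[of _ w]) (auto simp: eval_gprod valid_word_def)
qed

lemma word_length_eq_wlen:
  assumes "x \<in> carrier G"
  shows "word_length G gens x = wlen G T x"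
  unfolding word_length_def
proof (rule Least_equality)
  show "\<exists>w. valid w \<and> length w = wlen G T x \<and> eval w = x"
    using geodesic_word_exists[OF assms] by blast
qed (use wlen_eval_le in auto)

text \<open>Chosen, not computed. The algorithm contains it only for the images of the finitely many
  letters, where it is a constant.\<close>

definition geo :: "'a \<Rightarrow> nat list" where
  "geo x = (SOME w. valid w \<and> eval w = x \<and> length w = wlen G T x)"

lemma geo:
  assumes "x \<in> carrier G"
  shows "valid (geo x)" "eval (geo x) = x" "length (geo x) = wlen G T x"
  using someI_ex[OF geodesic_word_exists[OF assms]] unfolding geo_def by auto

lemma geodesic_geo:
  assumes "x \<in> carrier G"
  shows "M.geodesic (\<lambda>i. eval (take i (geo x))) (wlen G T x)"
proof -
  have "M.geodesic (\<lambda>i. \<one> \<otimes> gprod G (take i (map (letter_val G gens) (geo x)))) 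
      (length (map (letter_val G gens) (geo x)))"
    using geo[OF assms] valid_letters by (intro geodesic_word) (auto simp: eval_gprod[symmetric])
  moreover have "\<one> \<otimes> gprod G (take i (map (letter_val G gens) (geo x))) = eval (take i (geo x))" for i
    using geo[OF assms] by (simp add: take_map eval_gprod[symmetric])
  ultimately show ?thesis using geo(3)[OF assms] by simp
qed

subsection \<open>Rewriting words\<close>

definition short_relations :: "nat \<Rightarrow> (nat list \<times> nat list) set" where
  "short_relations M = {(a, b). valid a \<and> valid b \<and> length a \<le> M \<and> length b \<le> M \<and> eval a = eval b}"

lemma finite_short_relations: "finite (short_relations M)"
proof -
  have "finite {w. set w \<subseteq> {..<2 * length gens} \<and> length w \<le> M}"
    by (intro finite_lists_length_le) simp
  then have "finite ({w. set w \<subseteq> {..<2 * length gens} \<and> length w \<le> M} \<times> {w. set w \<subseteq> {..<2 * length gens} \<and> length w \<le> M})"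
    by simp
  then show ?thesis
    by (rule rev_finite_subset) (auto simp: short_relations_def valid_word_def)
qed

text \<open>Validity and the length bound are imposed on both words, so the relation is symmetric
  and never leaves the space searched later.\<close>

definition replace :: "nat \<Rightarrow> nat \<Rightarrow> nat list \<Rightarrow> nat list \<Rightarrow> bool" where
  "replace M L w w' \<longleftrightarrow> valid w \<and> valid w' \<and> length w \<le> L \<and> length w' \<le> L \<and>
    (\<exists>x y. \<exists>(a, b) \<in> short_relations M. w = x @ a @ y \<and> w' = x @ b @ y)"

lemma replace_sym: "replace M L w w' \<Longrightarrow> replace M L w' w"
  unfolding replace_def short_relations_def by fastforce

lemma replaces_sym: "(replace M L)\<^sup>*\<^sup>* w w' \<Longrightarrow> (replace M L)\<^sup>*\<^sup>* w' w"
  by (rule sympD[OF symp_rtranclp]) (auto intro: sympI replace_sym)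

text \<open>Two fellow travelling words bound a ladder whose rungs have length at most D; the words are
  exchanged one rung at a time.\<close>

lemma replaces_fellow_travelling:
  assumes v: "valid \<alpha>" "valid \<beta>" "valid r" and eq: "eval \<alpha> = eval \<beta>"
    and D: "\<And>t. wlen G T (inv (eval (take t \<beta>)) \<otimes> eval (take t \<alpha>)) \<le> D" "Suc D \<le> M"
    and L: "max (length \<alpha>) (length \<beta>) + D + length r \<le> L"
  shows "(replace M L)\<^sup>*\<^sup>* (\<alpha> @ r) (\<beta> @ r)"
proof -
  define c where "c t = geo (inv (eval (take t \<beta>)) \<otimes> eval (take t \<alpha>))" for t
  \<comment> \<open>Follow \<beta> for \<open>t\<close> letters, cross by the rung
    \<open>c t\<close>, and continue along \<alpha>.\<close>
  define W where "W t = take t \<beta> @ c t @ drop t \<alpha> @ r" for t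
  have cc: "inv (eval (take t \<beta>)) \<otimes> eval (take t \<alpha>) \<in> carrier G" for t using v by simp
  have c: "valid (c t)" "eval (c t) = inv (eval (take t \<beta>)) \<otimes> eval (take t \<alpha>)" "length (c t) \<le> D" for t
    using geo[OF cc] D(1) by (simp_all add: c_def)
  have valid_W: "valid (W t)" for t using v c by (simp add: W_def)
  have length_W: "length (W t) \<le> L" for t using L c(3)[of t] by (simp add: W_def)
  have step: "replace M L (W t) (W (Suc t))" for t
  proof -
    \<comment> \<open>The next letters, or empty words past the end, so that \<alpha> and \<beta>
      may differ in length.\<close>
    let ?a = "take 1 (drop t \<alpha>)" and ?b = "take 1 (drop t \<beta>)"
    have take_S: "take (Suc t) w = take t w @ take 1 (drop t w)" for w :: "nat list"
      using take_add[of t 1 w] by simp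
    have drop_S: "drop t w = take 1 (drop t w) @ drop (Suc t) w" for w :: "nat list"
      using append_take_drop_id[of 1 "drop t w"] by simp
    have "eval (?b @ c (Suc t)) = eval ?b \<otimes> (inv (eval (take t \<beta> @ ?b)) \<otimes> eval (take t \<alpha> @ ?a))"
    proof -
      have "eval (c (Suc t)) = inv (eval (take t \<beta> @ ?b)) \<otimes> eval (take t \<alpha> @ ?a)"
        using c(2)[of "Suc t"] by (simp only: take_S)
      then show ?thesis using v c(1) by (simp only: eval_append valid_take valid_drop)
    qed
    also have "\<dots> = eval ?b \<otimes> (inv (eval ?b) \<otimes> (inv (eval (take t \<beta>)) \<otimes> (eval (take t \<alpha>) \<otimes> eval ?a)))"
      using v by (simp add: eval_append inv_mult_group m_assoc)
    also have "\<dots> = (inv (eval (take t \<beta>)) \<otimes> (eval (take t \<alpha>) \<otimes> eval ?a))"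
      using v by (simp add: m_assoc[symmetric])
    also have "\<dots> = eval (c t @ ?a)" using v c by (simp add: eval_append m_assoc)
    \<comment> \<open>Two successive rungs and two letters bound a rectangle, whose two ways round
      have at most \<open>Suc D\<close> letters each.\<close>
    finally have "(c t @ ?a, ?b @ c (Suc t)) \<in> short_relations M"
      using v c(1) c(3)[of t] c(3)[of "Suc t"] D(2) by (auto simp: short_relations_def)
    moreover have "W t = take t \<beta> @ (c t @ ?a) @ (drop (Suc t) \<alpha> @ r)"
      unfolding W_def by (subst drop_S) simp
    moreover have "W (Suc t) = take t \<beta> @ (?b @ c (Suc t)) @ (drop (Suc t) \<alpha> @ r)"
      unfolding W_def by (subst take_S) simp
    ultimately show ?thesis
      unfolding replace_def using valid_W length_W by blast
  qed
  have "(replace M L)\<^sup>*\<^sup>* (W 0) (W t)" for t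
  proof (induction t)
    case (Suc t)
    then show ?case using step by (rule rtranclp.rtrancl_into_rtrancl)
  qed simp
  \<comment> \<open>The first and the last rung are trivial, because the two words start together
    and have the same value.\<close>
  moreover have "c 0 = []" using geo(3)[OF cc[of 0]] by (simp add: c_def wlen_one)
  moreover have "c (max (length \<alpha>) (length \<beta>)) = []"
    using geo(3)[OF cc[of "max (length \<alpha>) (length \<beta>)"]] v eq by (simp add: c_def wlen_one)
  ultimately have "(replace M L)\<^sup>*\<^sup>* (\<alpha> @ r) (take (max (length \<alpha>) (length \<beta>)) \<beta> @ drop (max (length \<alpha>) (length \<beta>)) \<alpha> @ r)"
    by (metis W_def append_Nil drop0 take0)
  then show ?thesis by simp
qed

end

locale hyperbolic_word_group = word_group +
  fixes \<Delta> :: nat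
  assumes hyp: "hyperbolic_metric (carrier G) (wdist G T) \<Delta>"
begin

sublocale H: hyperbolic_metric "carrier G" "wdist G T" \<Delta> by (rule hyp)

text \<open>The geodesics to \<open>x\<close> and to its neighbour end at distance at most 1, hence
  stay within \<open>2 * \<Delta> + 1\<close>. This is the rung length, and one letter more gives
  the relation size \<open>2 * \<Delta> + 2\<close>.\<close>

lemma replaces_geo_snoc:
  assumes x: "x \<in> carrier G" and k: "k < 2 * length gens" and r: "valid r"
    and L: "wlen G T x + length r + 2 * \<Delta> + 2 \<le> L"
  shows "(replace (2 * \<Delta> + 2) L)\<^sup>*\<^sup>* (geo x @ k # r) (geo (x \<otimes> letter_val G gens k) @ r)"
proof -
  let ?s = "letter_val G gens k"
  let ?y = "x \<otimes> ?s" and ?\<alpha> = "geo x @ [k]"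
  let ?\<beta> = "geo ?y"
  have s: "?s \<in> carrier G" "?y \<in> carrier G" using k x by auto
  have "wlen G T (eval [k]) \<le> 1" using k wlen_eval_le[of "[k]"] by simp
  then have ws: "wlen G T ?s \<le> 1" using s by simp
  then have ny: "wlen G T ?y \<le> Suc (wlen G T x)" using wlen_mult_le[OF x s(1)] by simp
  have \<alpha>: "valid ?\<alpha>" "eval ?\<alpha> = ?y" using geo[OF x] k x by (simp_all add: eval_append)
  note \<beta> = geo[OF s(2)]
  have "wlen G T (inv (eval (take t ?\<beta>)) \<otimes> eval (take t ?\<alpha>)) \<le> 2 * \<Delta> + 1" for t
  proof (cases "t \<le> wlen G T x")
    case True
    have "wdist G T (eval (take t (geo x))) (eval (take (min t (wlen G T ?y)) ?\<beta>))
      \<le> wdist G T (eval (take (wlen G T x) (geo x))) (eval (take (wlen G T ?y) ?\<beta>)) + 2 * \<Delta>"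
      using True by (intro H.geodesics_fellow_travel[OF geodesic_geo[OF x] geodesic_geo[OF s(2)]]) auto
    also have "wdist G T (eval (take (wlen G T x) (geo x))) (eval (take (wlen G T ?y) ?\<beta>)) \<le> 1"
      using geo[OF x] \<beta> ws x s by (simp add: wdist_def m_assoc[symmetric])
    also have "eval (take (min t (wlen G T ?y)) ?\<beta>) = eval (take t ?\<beta>)"
      using \<beta>(3) by (cases "t \<le> wlen G T ?y") (auto simp: min_def)
    finally have "wdist G T (eval (take t (geo x))) (eval (take t ?\<beta>)) \<le> 2 * \<Delta> + 1" by simp
    then have "wdist G T (eval (take t ?\<beta>)) (eval (take t (geo x))) \<le> 2 * \<Delta> + 1"
      using M.sym geo[OF x] \<beta> by simp
    then show ?thesis using True geo(3)[OF x] by (simp add: wdist_def)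
  next
    \<comment> \<open>Here \<open>t\<close> exceeds the length of \<open>geo x\<close>, so both
      words are used up and have the same value.\<close>
    case False
    then show ?thesis using ny geo(3)[OF x] \<beta> \<alpha> s by (simp add: wlen_one)
  qed
  from replaces_fellow_travelling[OF \<alpha>(1) \<beta>(1) r _ this, of "2 * \<Delta> + 2" L] L ny geo(3)[OF x] \<beta> \<alpha>(2)
  show ?thesis by simp
qed

text \<open>One prefix at a time is made geodesic. A geodesic is no longer than the prefix it
  replaces, so the slack \<open>2 * \<Delta> + 2\<close> is needed only once and does not
  accumulate.\<close>

lemma replaces_geo:
  assumes w: "valid w" and L: "length w + 2 * \<Delta> + 2 \<le> L"
  shows "(replace (2 * \<Delta> + 2) L)\<^sup>*\<^sup>* w (geo (eval w))"
proof -
  have "(replace (2 * \<Delta> + 2) L)\<^sup>*\<^sup>* w (geo (eval (take j w)) @ drop j w)" if "j \<le> length w" for j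
    using that
  proof (induction j)
    case 0
    have "geo \<one> = []" using geo(3)[of \<one>] by (simp add: wlen_one)
    then show ?case by simp
  next
    case (Suc j)
    then have j: "j < length w" by simp
    have k: "w ! j < 2 * length gens" using w j by (simp add: valid_word_def)
    have "take (Suc j) w = take j w @ [w ! j]" using j by (rule take_Suc_conv_app_nth)
    then have ev: "eval (take (Suc j) w) = eval (take j w) \<otimes> letter_val G gens (w ! j)"
      using w k by (simp add: eval_append)
    have "wlen G T (eval (take j w)) \<le> j" using wlen_eval_le[of "take j w"] w j by simp
    then have "(replace (2 * \<Delta> + 2) L)\<^sup>*\<^sup>* (geo (eval (take j w)) @ w ! j # drop (Suc j) w)
        (geo (eval (take (Suc j) w)) @ drop (Suc j) w)"
      unfolding ev using w k L j by (intro replaces_geo_snoc) auto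
    with Suc j show ?case by (simp add: Cons_nth_drop_Suc)
  qed
  from this[of "length w"] show ?thesis by simp
qed


section \<open>Length of the intermediate twisted conjugates\<close>

text \<open>Displacement under \<open>\<lambda>x. u \<otimes> \<phi> x\<close> at \<open>x\<close>
  is the length of the twisted conjugate of \<open>u\<close> by \<open>x\<close>; at the ends
  \<open>\<one>\<close> and \<open>g\<close> these are \<open>u\<close> and its conjugate by
  \<open>g\<close>. The auxiliary path between these ends is geodesic for the invariant set
  \<open>T'\<close>.\<close>

lemma twisted_displacement:
  assumes \<phi>: "\<phi> \<in> hom G G" and N: "0 < N" "\<And>x. x \<in> carrier G \<Longrightarrow> (\<phi> ^^ N) x = x"
  obtains C where "\<And>u g i. \<lbrakk>u \<in> carrier G; g \<in> carrier G; i \<le> wlen G T g\<rbrakk> \<Longrightarrow>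
    wlen G T (inv (eval (take i (geo g))) \<otimes> (u \<otimes> \<phi> (eval (take i (geo g)))))
      \<le> C * (wlen G T u + wlen G T (inv g \<otimes> (u \<otimes> \<phi> g)) + 1)"
proof -
  interpret \<phi>: group_hom G G \<phi> using \<phi> by (simp add: group_hom_def group_hom_axioms_def is_group)
  obtain T' where T': "generated_group G T'" "T \<subseteq> T'" "finite T'"
    and inv: "\<And>x. x \<in> carrier G \<Longrightarrow> wlen G T' (\<phi> x) = wlen G T' x"
    using invariant_generators[OF \<phi> N] by (metis finite_imageI finite_lessThan)
  interpret T': generated_group G T' by fact
  obtain l where l: "\<And>x. x \<in> carrier G \<Longrightarrow> wlen G T x \<le> l * wlen G T' x"
    using wlen_bilipschitz[OF T'(1,3)] by blast
  have lip: "wdist G T' x y \<le> wdist G T x y" "wdist G T x y \<le> l * wdist G T' x y"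
    if "x \<in> carrier G" "y \<in> carrier G" for x y
    using that wlen_antimono[OF T'(1,2)] l by (simp_all add: wdist_def)
  show thesis
  proof (rule H.isometry_displacement_on_geodesic[OF T'.metric lip])
    fix C assume C: "\<And>\<psi> p m c n c' n' i.
    \<lbrakk>\<And>x. x \<in> carrier G \<Longrightarrow> \<psi> x \<in> carrier G;
     \<And>x y. x \<in> carrier G \<Longrightarrow> y \<in> carrier G \<Longrightarrow> wdist G T' (\<psi> x) (\<psi> y) = wdist G T' x y;
     T'.M.geodesic p m; M.geodesic c n; M.geodesic c' n'; c 0 = p 0; c n = p m;
     c' 0 = \<psi> (p 0); c' n' = \<psi> (p m); i \<le> n\<rbrakk>
    \<Longrightarrow> wdist G T (c i) (\<psi> (c i)) \<le> C * (wdist G T (p 0) (\<psi> (p 0)) + wdist G T (p m) (\<psi> (p m)) + 1)"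
  show thesis
  proof (rule that[of C])
    fix u g i assume u: "u \<in> carrier G" and g: "g \<in> carrier G" and i: "i \<le> wlen G T g"
    obtain p m where p: "T'.M.geodesic p m" "p 0 = \<one>" "p m = g"
      using T'.exists_geodesic[of \<one> g] g by blast
    obtain c' n' where c': "M.geodesic c' n'" "c' 0 = u \<otimes> \<phi> \<one>" "c' n' = u \<otimes> \<phi> g"
      using exists_geodesic[of "u \<otimes> \<phi> \<one>" "u \<otimes> \<phi> g"] u g by auto
    have iso: "wdist G T' (u \<otimes> \<phi> x) (u \<otimes> \<phi> y) = wdist G T' x y"
      if "x \<in> carrier G" "y \<in> carrier G" for x y
    proof -
      have "inv (u \<otimes> \<phi> x) \<otimes> (u \<otimes> \<phi> y) = \<phi> (inv x \<otimes> y)"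
        using that u by (simp add: inv_mult_left_cancel)
      with inv[of "inv x \<otimes> y"] that show ?thesis by (simp add: wdist_def)
    qed
    have "wdist G T (eval (take i (geo g))) (u \<otimes> \<phi> (eval (take i (geo g))))
      \<le> C * (wdist G T (p 0) (u \<otimes> \<phi> (p 0)) + wdist G T (p m) (u \<otimes> \<phi> (p m)) + 1)"
      by (rule C[OF _ iso p(1) geodesic_geo[OF g] c'(1)])
        (use u i p c' geo[OF g] in auto)
    then show "wlen G T (inv (eval (take i (geo g))) \<otimes> (u \<otimes> \<phi> (eval (take i (geo g)))))
      \<le> C * (wlen G T u + wlen G T (inv g \<otimes> (u \<otimes> \<phi> g)) + 1)"
      using u p by (simp add: wdist_def)
    qed
  qed
qed

end

subsection \<open>Deciding twisted conjugacy\<close>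

context word_group
begin

text \<open>Free of length bounds, so that soundness can be proved without them. Conjugation by a
  letter merely adds letters at both ends; shortening is left to the relations.\<close>

definition twisted_step :: "nat \<Rightarrow> ('a \<Rightarrow> 'a) \<Rightarrow> nat list \<Rightarrow> nat list \<Rightarrow> bool" where
  "twisted_step M \<phi> w w' \<longleftrightarrow>
    (\<exists>x y. \<exists>(a, b) \<in> short_relations M. w = x @ a @ y \<and> w' = x @ b @ y) \<or>
    (\<exists>k<2 * length gens. w' = inverse_letter k # w @ geo (\<phi> (letter_val G gens k)))"

lemma eval_twisted_step:
  assumes \<phi>: "\<phi> \<in> hom G G" and w: "valid w" and k: "k < 2 * length gens"
  shows "valid (inverse_letter k # w @ geo (\<phi> (letter_val G gens k)))"
    "eval (inverse_letter k # w @ geo (\<phi> (letter_val G gens k))) =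
      inv (letter_val G gens k) \<otimes> (eval w \<otimes> \<phi> (letter_val G gens k))"
proof -
  have gens: "set gens \<subseteq> carrier G" using generates by (simp add: generates_def)
  have "\<phi> (letter_val G gens k) \<in> carrier G" using hom_in_carrier[OF \<phi>] k by simp
  note g = geo[OF this]
  show "valid (inverse_letter k # w @ geo (\<phi> (letter_val G gens k)))"
    using g w letter_val_inverse(1)[OF gens k] by simp
  show "eval (inverse_letter k # w @ geo (\<phi> (letter_val G gens k))) =
      inv (letter_val G gens k) \<otimes> (eval w \<otimes> \<phi> (letter_val G gens k))"
    using g w letter_val_inverse[OF gens k] by (simp add: eval_append)
qed

lemma twisted_conj_refl:
  assumes "\<phi> \<in> hom G G" "u \<in> carrier G"
  shows "twisted_conj G \<phi> u u"
  using assms hom_one[OF assms(1)] is_group unfolding twisted_conj_def by (intro bexI[of _ \<one>]) auto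

text \<open>Twisted conjugation is a right action, so conjugation by \<open>g\<close> can be carried
  out one letter of \<open>g\<close> at a time.\<close>

lemma twisted_conj_mult:
  assumes \<phi>: "\<phi> \<in> hom G G" and "u \<in> carrier G" "g \<in> carrier G" "h \<in> carrier G"
  shows "inv (g \<otimes> h) \<otimes> (u \<otimes> \<phi> (g \<otimes> h)) = inv h \<otimes> ((inv g \<otimes> (u \<otimes> \<phi> g)) \<otimes> \<phi> h)"
  using assms hom_in_carrier[OF \<phi>] by (simp add: inv_mult_group hom_mult m_assoc)

lemma twisted_conj_step:
  assumes \<phi>: "\<phi> \<in> hom G G" and u: "u \<in> carrier G" and "twisted_conj G \<phi> u v" "h \<in> carrier G"
  shows "twisted_conj G \<phi> u (inv h \<otimes> (v \<otimes> \<phi> h))"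
proof -
  obtain g where "g \<in> carrier G" "v = inv g \<otimes> u \<otimes> \<phi> g"
    using assms(3) by (auto simp: twisted_conj_def)
  then show ?thesis
    unfolding twisted_conj_def using twisted_conj_mult[OF \<phi> u _ assms(4)] u assms(4) hom_in_carrier[OF \<phi>]
    by (intro bexI[of _ "g \<otimes> h"]) (auto simp: m_assoc)
qed

lemma twisted_steps_sound:
  assumes \<phi>: "\<phi> \<in> hom G G" and "(twisted_step M \<phi>)\<^sup>*\<^sup>* u v" "valid u"
  shows "valid v \<and> twisted_conj G \<phi> (eval u) (eval v)"
  using assms(2)
proof (induction rule: rtranclp_induct)
  case base
  then show ?case using assms by (simp add: twisted_conj_refl)
next
  case (step w w')
  from step(2) consider x y a b where "(a, b) \<in> short_relations M" "w = x @ a @ y" "w' = x @ b @ y"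
    | k where "k < 2 * length gens" "w' = inverse_letter k # w @ geo (\<phi> (letter_val G gens k))"
    unfolding twisted_step_def by blast
  then show ?case
  proof cases
    case 1
    then have "valid w'" "eval w' = eval w" using step(3) by (auto simp: short_relations_def eval_append)
    with step(3) show ?thesis by simp
  next
    case 2
    with step(3) show ?thesis
      using eval_twisted_step[OF \<phi>, of w k] twisted_conj_step[OF \<phi>, of "eval u" "eval w"] assms(3)
      by simp
  qed
qed

definition bounded_step :: "nat \<Rightarrow> nat \<Rightarrow> ('a \<Rightarrow> 'a) \<Rightarrow> nat list \<Rightarrow> nat list \<Rightarrow> bool" where
  "bounded_step M L \<phi> w w' \<longleftrightarrow>
    twisted_step M \<phi> w w' \<and> valid w \<and> valid w' \<and> length w \<le> L \<and> length w' \<le> L"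

lemma replaces_bounded_steps: "(replace M L)\<^sup>*\<^sup>* w w' \<Longrightarrow> (bounded_step M L \<phi>)\<^sup>*\<^sup>* w w'"
  by (erule rtranclp_mono[THEN predicate2D, rotated])
    (auto simp: replace_def bounded_step_def twisted_step_def)

end

context hyperbolic_word_group
begin

text \<open>The chain runs through geodesic words for the twisted conjugates of \<open>u\<close> by
  the prefixes of a geodesic word for \<open>g\<close>. \<open>twisted_displacement\<close> bounds
  all of them, however long \<open>g\<close> is.\<close>

lemma bounded_steps_complete:
  assumes \<phi>: "\<phi> \<in> hom G G" and N: "0 < N" "\<And>x. x \<in> carrier G \<Longrightarrow> (\<phi> ^^ N) x = x"
  obtains C where "\<And>u v L. \<lbrakk>valid u; valid v; twisted_conj G \<phi> (eval u) (eval v);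
    C * (length u + length v + 1) \<le> L\<rbrakk> \<Longrightarrow> (bounded_step (2 * \<Delta> + 2) L \<phi>)\<^sup>*\<^sup>* u v"
proof -
  obtain C where C: "\<And>u g i. \<lbrakk>u \<in> carrier G; g \<in> carrier G; i \<le> wlen G T g\<rbrakk> \<Longrightarrow>
    wlen G T (inv (eval (take i (geo g))) \<otimes> (u \<otimes> \<phi> (eval (take i (geo g)))))
      \<le> C * (wlen G T u + wlen G T (inv g \<otimes> (u \<otimes> \<phi> g)) + 1)"
    using twisted_displacement[OF \<phi> N] by blast
  define F where "F = Max (insert 0 ((\<lambda>k. length (geo (\<phi> (letter_val G gens k)))) ` {..<2 * length gens}))"
  have F: "length (geo (\<phi> (letter_val G gens k))) \<le> F" if "k < 2 * length gens" for k
    unfolding F_def using that by (intro Max_ge) auto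
  show thesis
  \<comment> \<open>Applied to \<open>length u + length v + 1\<close>, the summand \<open>C\<close>
    covers the intermediate conjugates, 1 covers the given words and the added inverse letter,
    \<open>F\<close> the image of a letter, and \<open>2 * \<Delta> + 2\<close> the slack of
    \<open>replaces_geo\<close>.\<close>
  proof (rule that[of "C + F + 2 * \<Delta> + 3"])
    fix u v L
    assume u: "valid u" and v: "valid v" and uv: "twisted_conj G \<phi> (eval u) (eval v)"
      and L: "(C + F + 2 * \<Delta> + 3) * (length u + length v + 1) \<le> L"
    let ?S = "bounded_step (2 * \<Delta> + 2) L \<phi>"
    define K where "K = C * (length u + length v + 1)"
    have "K + (length u + length v + 1) + F + 2 * \<Delta> + 2 \<le> L"
      using L by (simp add: K_def algebra_simps)
    then have L: "length u + 2 * \<Delta> + 2 \<le> L" "length v + 2 * \<Delta> + 2 \<le> L" "Suc K + F + 2 * \<Delta> + 2 \<le> L"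
      by linarith+
    have to_geo: "?S\<^sup>*\<^sup>* w (geo (eval w))" "?S\<^sup>*\<^sup>* (geo (eval w)) w"
      if "valid w" "length w + 2 * \<Delta> + 2 \<le> L" for w
      using replaces_geo[OF that] replaces_sym[OF replaces_geo[OF that]] by (auto intro: replaces_bounded_steps)
    obtain g where g: "g \<in> carrier G" "inv g \<otimes> (eval u \<otimes> \<phi> g) = eval v"
      using uv u hom_in_carrier[OF \<phi>] by (auto simp: twisted_conj_def m_assoc)
    define w where "w = geo g"
    note w = geo[OF g(1), folded w_def]
    define U where "U i = inv (eval (take i w)) \<otimes> (eval u \<otimes> \<phi> (eval (take i w)))" for i
    have Uc: "U i \<in> carrier G" for i using u w hom_in_carrier[OF \<phi>] by (simp add: U_def)
    have UK: "wlen G T (U i) \<le> K" if "i \<le> length w" for i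
    proof -
      have "wlen G T (U i) \<le> C * (wlen G T (eval u) + wlen G T (eval v) + 1)"
        using C[of "eval u" g i] g u that w unfolding U_def w_def by simp
      also have "\<dots> \<le> K" unfolding K_def using u v by (intro mult_left_mono add_mono wlen_eval_le) auto
      finally show ?thesis .
    qed
    \<comment> \<open>One conjugation by the next letter gives a word of length at most
      \<open>K + F + 1\<close>, which the relations then make geodesic.\<close>
    have step: "?S\<^sup>*\<^sup>* (geo (U i)) (geo (U (Suc i)))" if i: "i < length w" for i
    proof -
      let ?k = "w ! i"
      let ?w' = "inverse_letter ?k # geo (U i) @ geo (\<phi> (letter_val G gens ?k))"
      have k: "?k < 2 * length gens" using w(1) i by (simp add: valid_word_def)
      have "take (Suc i) w = take i w @ [?k]" using i by (rule take_Suc_conv_app_nth)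
      then have "eval (take (Suc i) w) = eval (take i w) \<otimes> letter_val G gens ?k"
        using w k by (simp add: eval_append)
      then have "U (Suc i) = inv (letter_val G gens ?k) \<otimes> (U i \<otimes> \<phi> (letter_val G gens ?k))"
        unfolding U_def using u w k by (simp add: twisted_conj_mult[OF \<phi>])
      then have w': "valid ?w'" "eval ?w' = U (Suc i)"
        using eval_twisted_step[OF \<phi> geo(1)[OF Uc[of i]] k] geo(2)[OF Uc[of i]] by simp_all
      have len: "length (geo (U i)) \<le> K" using geo(3)[OF Uc] UK i by simp
      have "?S (geo (U i)) ?w'"
        unfolding bounded_step_def twisted_step_def using w'(1) geo(1)[OF Uc[of i]] k len F[OF k] L(3) by auto
      moreover have "?S\<^sup>*\<^sup>* ?w' (geo (U (Suc i)))"
        using to_geo(1)[OF w'(1)] w'(2) len F[OF k] L(3) by simp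
      ultimately show ?thesis by (rule converse_rtranclp_into_rtranclp)
    qed
    have "?S\<^sup>*\<^sup>* (geo (U 0)) (geo (U i))" if "i \<le> length w" for i
      using that
    proof (induction i)
      case (Suc i)
      then have "?S\<^sup>*\<^sup>* (geo (U 0)) (geo (U i))" by simp
      also have "?S\<^sup>*\<^sup>* (geo (U i)) (geo (U (Suc i)))" using Suc by (intro step) simp
      finally show ?case .
    qed simp
    then have "?S\<^sup>*\<^sup>* (geo (U 0)) (geo (U (length w)))" by simp
    moreover have "U 0 = eval u" using u hom_one[OF \<phi>] is_group by (simp add: U_def)
    moreover have "U (length w) = eval v" using w g by (simp add: U_def)
    ultimately have "?S\<^sup>*\<^sup>* (geo (eval u)) (geo (eval v))" by simp
    with to_geo(1)[OF u L(1)] to_geo(2)[OF v L(2)] show "?S\<^sup>*\<^sup>* u v" by (meson rtranclp_trans)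
  qed
qed

end

section \<open>Transfer to codes and the decision procedure\<close>

context word_group
begin

text \<open>The pieces \<open>x\<close> and \<open>y\<close> are bounded by \<open>c\<close> for the
  sake of decidability; by \<open>list_encode_append_le\<close> every prefix and suffix of a word
  has such a code.\<close>

definition code_step :: "nat \<Rightarrow> ('a \<Rightarrow> 'a) \<Rightarrow> nat \<Rightarrow> nat \<Rightarrow> bool" where
  "code_step M \<phi> c c' \<longleftrightarrow>
    (\<exists>p \<in> short_relations M. \<exists>x\<le>c. \<exists>y\<le>c. c = code_append x (code_append (list_encode (fst p)) y) \<and>
      c' = code_append x (code_append (list_encode (snd p)) y)) \<or>
    (\<exists>k \<in> {..<2 * length gens}. c' =
      code_cons (inverse_letter k) (code_append c (list_encode (geo (\<phi> (letter_val G gens k))))))"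

lemma code_step_encode:
  "code_step M \<phi> (list_encode w) (list_encode w') \<longleftrightarrow> twisted_step M \<phi> w w'"
proof -
  have inj: "list_encode a = list_encode b \<longleftrightarrow> a = b" for a b
    using inj_list_encode by (auto dest: injD)
  have ex: "(\<exists>x\<le>n. P x) \<longleftrightarrow> (\<exists>x. list_encode x \<le> n \<and> P (list_encode x))" for n P
    by (metis list_decode_inverse)
  have le: "list_encode x \<le> list_encode (x @ a @ y)" "list_encode y \<le> list_encode (x @ a @ y)" for x a y
    using list_encode_append_le(1)[of x "a @ y"] list_encode_append_le(2)[of y "x @ a"] by simp_all
  have "(\<exists>x\<le>list_encode w. \<exists>y\<le>list_encode w.
      list_encode w = code_append x (code_append (list_encode a) y) \<and>
      list_encode w' = code_append x (code_append (list_encode b) y)) \<longleftrightarrow>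
    (\<exists>x y. w = x @ a @ y \<and> w' = x @ b @ y)" for a b
    unfolding ex by (simp add: inj) (metis le)
  then show ?thesis
    unfolding code_step_def twisted_step_def by (auto simp: inj Bex_def)
qed

lemma decidable_code_step:
  assumes "computable n F" "computable n H"
  shows "decidable n (\<lambda>xs. code_step M \<phi> (F xs) (H xs))"
proof -
  have "decidable (Suc (Suc 0)) (\<lambda>xs. code_step M \<phi> (hd xs) (hd (tl xs)))"
    unfolding code_step_def
    by (intro decidable_disj decidable_bex_finite decidable_ex_le decidable_conj decidable_eq
        computable_code_append computable_code_cons computable_const computable_var
        finite_short_relations finite_lessThan) auto
  then show ?thesis using assms by (rule decidable_comp2)
qed

text \<open>Every number codes a list, so a chain of numbers decodes to a chain of words, along
  which validity spreads from \<open>u\<close>.\<close>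

lemma code_reachable_sound:
  assumes \<phi>: "\<phi> \<in> hom G G" and u: "valid u"
    and R: "(\<lambda>c c'. code_step M \<phi> c c' \<and> c \<le> B \<and> c' \<le> B)\<^sup>*\<^sup>* (list_encode u) (list_encode v)"
  shows "twisted_conj G \<phi> (eval u) (eval v)"
proof -
  have "(twisted_step M \<phi>)\<^sup>*\<^sup>* u (list_decode c)"
    if "(\<lambda>c c'. code_step M \<phi> c c' \<and> c \<le> B \<and> c' \<le> B)\<^sup>*\<^sup>* (list_encode u) c" for c
    using that
  proof (induction rule: rtranclp_induct)
    case (step c c')
    have "twisted_step M \<phi> (list_decode c) (list_decode c')"
      using step(2) code_step_encode[of M \<phi> "list_decode c" "list_decode c'"] by simp
    with step(3) show ?case by (rule rtranclp.rtrancl_into_rtrancl)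
  qed simp
  from this[OF R] show ?thesis using twisted_steps_sound[OF \<phi> _ u] by simp
qed

lemma code_reachable_complete:
  assumes R: "(bounded_step M L \<phi>)\<^sup>*\<^sup>* u v" and B: "code_bound (2 * length gens) L \<le> B"
  shows "(\<lambda>c c'. code_step M \<phi> c c' \<and> c \<le> B \<and> c' \<le> B)\<^sup>*\<^sup>* (list_encode u) (list_encode v)"
  using R
proof (induction rule: rtranclp_induct)
  case (step w w')
  have "list_encode x \<le> B" if "valid x" "length x \<le> L" for x
    using that B by (intro order_trans[OF list_encode_le_code_bound B]) (auto simp: valid_word_def)
  with step(2) have "code_step M \<phi> (list_encode w) (list_encode w') \<and> list_encode w \<le> B \<and> list_encode w' \<le> B"
    by (simp add: bounded_step_def code_step_encode)
  with step(3) show ?case by (rule rtranclp.rtrancl_into_rtrancl)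
qed simp

end

lemma (in hyperbolic_word_group) decidable_twisted_conj_problem:
  assumes \<phi>: "\<phi> \<in> hom G G" and N: "0 < N" "\<And>x. x \<in> carrier G \<Longrightarrow> (\<phi> ^^ N) x = x"
  shows "decidable_set (twisted_conj_problem G gens \<phi>)"
proof -
  obtain C where C: "\<And>u v L. \<lbrakk>valid u; valid v; twisted_conj G \<phi> (eval u) (eval v);
    C * (length u + length v + 1) \<le> L\<rbrakk> \<Longrightarrow> (bounded_step (2 * \<Delta> + 2) L \<phi>)\<^sup>*\<^sup>* u v"
    using bounded_steps_complete[OF \<phi> N] by blast
  define p where "p x = fst (prod_decode x)" for x
  define q where "q x = snd (prod_decode x)" for x
  \<comment> \<open>The summand \<open>p x\<close> keeps the start below the bound for every
    \<open>x\<close>, as \<open>decidable_bounded_reachability\<close> demands. Lengths of words are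
    estimated by their codes.\<close>
  define B where "B x = p x + code_bound (2 * length gens) (C * (p x + q x + 1))" for x
  define reach where "reach x \<longleftrightarrow>
    (\<lambda>c c'. code_step (2 * \<Delta> + 2) \<phi> c c' \<and> c \<le> B x \<and> c' \<le> B x)\<^sup>*\<^sup>* (p x) (q x)" for x
  define ok where "ok c \<longleftrightarrow> (\<forall>k \<in> set (list_decode c). k < 2 * length gens)" for c
  have "x \<in> twisted_conj_problem G gens \<phi> \<longleftrightarrow> ok (p x) \<and> ok (q x) \<and> reach x" for x
  proof -
    define u v where "u = list_decode (p x)" and "v = list_decode (q x)"
    have pq: "p x = list_encode u" "q x = list_encode v" by (simp_all add: u_def v_def)
    have x: "x = prod_encode (list_encode u, list_encode v)"
      by (simp add: u_def v_def p_def q_def)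
    have "x \<in> twisted_conj_problem G gens \<phi> \<longleftrightarrow> valid u \<and> valid v \<and> twisted_conj G \<phi> (eval u) (eval v)"
    proof -
      have "list_encode a = list_encode b \<longleftrightarrow> a = b" for a b
        using inj_list_encode by (auto dest: injD)
      then show ?thesis unfolding twisted_conj_problem_def x by auto
    qed
    also have "\<dots> \<longleftrightarrow> valid u \<and> valid v \<and> reach x"
    proof (intro conj_cong refl iffI)
      assume v: "valid u" "valid v"
      show "twisted_conj G \<phi> (eval u) (eval v)" if "reach x"
        using that code_reachable_sound[OF \<phi> v(1)] unfolding reach_def pq by blast
      assume tc: "twisted_conj G \<phi> (eval u) (eval v)"
      have "C * (length u + length v + 1) \<le> C * (p x + q x + 1)"
        unfolding pq by (intro mult_left_mono add_mono length_le_list_encode) auto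
      from code_reachable_complete[OF C[OF v tc this], of "B x"]
      show "reach x" unfolding reach_def by (simp add: B_def pq)
    qed
    finally show ?thesis by (simp add: valid_word_def ok_def u_def v_def)
  qed
  then have eq: "hd xs \<in> twisted_conj_problem G gens \<phi> \<longleftrightarrow> ok (p (hd xs)) \<and> ok (q (hd xs)) \<and> reach (hd xs)"
    for xs by simp
  have pq: "computable n (\<lambda>xs. p (F xs))" "computable n (\<lambda>xs. q (F xs))" if "computable n F" for n F
    unfolding p_def q_def using that by (auto intro: computable_prod_decode)
  have "decidable 1 (\<lambda>xs. reach (hd xs))"
    unfolding reach_def
  proof (rule decidable_bounded_reachability)
    show "computable n (\<lambda>xs. B (F xs))" if "computable n F" for n F
      unfolding B_def using that
      by (intro computable_add computable_code_bound computable_mult computable_const pq)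
  qed (auto intro: decidable_code_step pq simp: B_def)
  moreover have "decidable 1 (\<lambda>xs. ok (p (hd xs)))" "decidable 1 (\<lambda>xs. ok (q (hd xs)))"
    unfolding ok_def by (intro decidable_code_all_less pq computable_var, simp)+
  ultimately show ?thesis
    by (intro decidable_setI) (simp only: eq decidable_conj)
qed

lemma (in word_group) hyperbolic_metric_if_hyperbolic_group:
  assumes "hyperbolic_group G gens"
  obtains \<Delta> where "hyperbolic_metric (carrier G) (wdist G T) \<Delta>"
proof -
  obtain \<delta> :: real where \<delta>: "\<And>w x y z. \<lbrakk>w \<in> carrier G; x \<in> carrier G; y \<in> carrier G; z \<in> carrier G\<rbrakk> \<Longrightarrow>
      min (gromov_product G gens w x y) (gromov_product G gens w y z) - \<delta> \<le> gromov_product G gens w x z"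
    using assms unfolding hyperbolic_group_def by blast
  \<comment> \<open>Doubling clears the halves in \<open>gromov_product\<close>, and rounding up
    gives a natural number.\<close>
  define \<Delta> where "\<Delta> = nat \<lceil>2 * \<delta>\<rceil>"
  have \<Delta>: "2 * \<delta> \<le> real \<Delta>" unfolding \<Delta>_def by linarith
  have dist: "word_dist G gens x y = real (wdist G T x y)" if "x \<in> carrier G" "y \<in> carrier G" for x y
    using that by (simp add: word_dist_def wdist_def word_length_eq_wlen)
  have "hyperbolic_metric (carrier G) (wdist G T) \<Delta>"
  proof
    fix w x y z assume X: "w \<in> carrier G" "x \<in> carrier G" "y \<in> carrier G" "z \<in> carrier G"
    have "real (wdist G T x z + wdist G T y w)
      \<le> real (max (wdist G T x y + wdist G T z w) (wdist G T y z + wdist G T x w) + \<Delta>)"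
      using \<delta>[OF X] \<Delta> unfolding gromov_product_def
      by (simp add: dist X of_nat_max min_def max_def field_simps split: if_splits)
    then show "wdist G T x z + wdist G T y w
      \<le> max (wdist G T x y + wdist G T z w) (wdist G T y z + wdist G T x w) + \<Delta>"
      by (simp only: of_nat_le_iff)
  qed
  with that show thesis .
qed

theorem theorem5p1:
  fixes G :: "('g, 'm) monoid_scheme" and gens :: "'g list" and \<phi> :: "'g \<Rightarrow> 'g"
  assumes "group G"
    and "generates G gens"
    and "hyperbolic_group G gens"
    and "\<phi> \<in> iso G G"
    and "\<exists>n>0. \<forall>x\<in>carrier G. (\<phi> ^^ n) x = x"
  shows "decidable_set (twisted_conj_problem G gens \<phi>)"
proof -
  interpret word_group G gens
    using assms(1,2) by (simp add: word_group_def word_group_axioms_def)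
  obtain \<Delta> where "hyperbolic_metric (carrier G) (wdist G T) \<Delta>"
    using assms(3) by (rule hyperbolic_metric_if_hyperbolic_group)
  then interpret hyperbolic_word_group G gens \<Delta>
    by (intro hyperbolic_word_group.intro hyperbolic_word_group_axioms.intro word_group_axioms)
  have "\<phi> \<in> hom G G" using assms(4) by (simp add: iso_def)
  with assms(5) decidable_twisted_conj_problem show ?thesis by blast
qed

end
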